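(* Let $X$ and $Y$ be locally compact Polish spaces. Every strongly $\sigma$-additive and weakly continuous transfunction $\Phi:\mathcal{M}_{fr}(X)\to\mathcal{M}_{fr}(Y)$ has a strongly $\sigma$-additive and weakly continuous Radon adjoint $S:\mathcal{C}_b(Y)\to\mathcal{C}_b(X)$. Conversely, every strongly $\sigma$-additive and weakly continuous operator $S:\mathcal{C}_b(Y)\to\mathcal{C}_b(X)$ has a strongly $\sigma$-additive and weakly continuous Radon adjoint $\Phi:\mathcal{M}_{fr}(X)\to\mathcal{M}_{fr}(Y)$. Whenever $(\Phi,S)$ is such a Radon adjoint pair, $\|\Phi\|=\|S\|$, where the operator norms are taken with respect to the total variation norms and the uniform norms, respectively.
   Context: $\mathcal{C}_b(X)$ is the Banach space of bounded continuous functions $X\to\mathbb{R}$ with the uniform norm, and $\mathcal{M}_{fr}(X)$ is the Banach space of all finite (hence regular) signed Borel measures on $X$ with the total variation norm; similarly for $Y$. For a function $f$ and a measure $\lambda$ on the same space, $\langle f,\lambda\rangle:=\int f\,d\lambda$. A transfunction is a function $\Phi$ between such spaces of measures. A transfunction, or an operator between Banach spaces, is strongly $\sigma$-additive if it is linear and norm-continuous (total variation norm for measures, uniform norm for functions). $\Phi:\mathcal{M}_{fr}(X)\to\mathcal{M}_{fr}(Y)$ and $S:\mathcal{C}_b(Y)\to\mathcal{C}_b(X)$ are Radon adjoints of each other if $\langle g,\Phi(\lambda)\rangle=\langle S(g),\lambda\rangle$ for all $g\in\mathcal{C}_b(Y)$ and $\lambda\in\mathcal{M}_{fr}(X)$.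 Weak convergence (of sequences): $f_n\xrightarrow{w}f$ in $\mathcal{C}_b(X)$ if $\langle f_n,\lambda\rangle\to\langle f,\lambda\rangle$ for every finite regular signed measure $\lambda$ on $X$ (equivalently, $(f_n)$ is uniformly bounded and converges pointwise to $f$); $\lambda_n\xrightarrow{w}\lambda$ in $\mathcal{M}_{fr}(X)$ if $\langle f,\lambda_n\rangle\to\langle f,\lambda\rangle$ for every bounded continuous $f:X\to\mathbb{R}$. $S$ is weakly continuous if $g_n\xrightarrow{w}g$ implies $Sg_n\xrightarrow{w}Sg$; $\Phi$ is weakly continuous if $\lambda_n\xrightarrow{w}\lambda$ implies $\Phi\lambda_n\xrightarrow{w}\Phi\lambda$. *)

theory Defs
  imports "HOL-Analysis.Analysis"
begin

text \<open>
  Finite signed Borel measures.  The value on non-measurable sets is fixed to \<open>0\<close> so that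
  equality of signed measures is equality of set functions on Borel sets.  On a Polish space
  all of them are regular, so the type below is the space of finite regular signed measures.
\<close>

definition signed_measures :: "('a::topological_space set \<Rightarrow> real) set" where
  "signed_measures = {m. m {} = 0 \<and>
     (\<forall>A. range A \<subseteq> sets borel \<longrightarrow> disjoint_family A \<longrightarrow> (\<lambda>i. m (A i)) sums m (\<Union>i::nat. A i)) \<and>
     (\<forall>A. A \<notin> sets borel \<longrightarrow> m A = 0)}"

typedef (overloaded) 'a signed_measure =
  "signed_measures :: ('a::topological_space set \<Rightarrow> real) set"
  morphisms smeasure Abs_signed_measure
proof
  show "(\<lambda>_. 0) \<in> signed_measures" by (simp add: signed_measures_def)
qed

setup_lifting type_definition_signed_measure

lemma smeasure_empty [simp]: "smeasure m {} = 0"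
  using smeasure[of m] by (simp add: signed_measures_def)

lemma smeasure_sums:
  "range A \<subseteq> sets borel \<Longrightarrow> disjoint_family A \<Longrightarrow>
    (\<lambda>i. smeasure m (A i)) sums smeasure m (\<Union>i::nat. A i)"
  using smeasure[of m] by (simp add: signed_measures_def)

lemma smeasure_notin: "A \<notin> sets borel \<Longrightarrow> smeasure m A = 0"
  using smeasure[of m] by (simp add: signed_measures_def)

lemma smeasure_eqI:
  "(\<And>A. A \<in> sets borel \<Longrightarrow> smeasure m A = smeasure n A) \<Longrightarrow> m = n"
  by (metis ext smeasure_inject smeasure_notin)

lemma smeasure_Un:
  assumes "A \<in> sets borel" "B \<in> sets borel" "A \<inter> B = {}"
  shows "smeasure m (A \<union> B) = smeasure m A + smeasure m B"
proof -
  have "(\<lambda>i. smeasure m (binaryset A B i)) sums smeasure m (\<Union>i. binaryset A B i)"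
    using assms by (intro smeasure_sums)
      (auto simp: binaryset_def disjoint_family_on_def split: if_splits)
  moreover have "(\<lambda>i. smeasure m (binaryset A B i)) sums (smeasure m A + smeasure m B)"
    by (rule binaryset_sums) simp
  ultimately show ?thesis
    by (simp add: UN_binaryset_eq sums_iff)
qed

lemma smeasure_Diff:
  assumes "A \<in> sets borel" "B \<in> sets borel" "B \<subseteq> A"
  shows "smeasure m (A - B) = smeasure m A - smeasure m B"
proof -
  have "smeasure m (B \<union> (A - B)) = smeasure m B + smeasure m (A - B)"
    using assms by (intro smeasure_Un) auto
  with assms(3) show ?thesis by (simp add: Un_absorb1)
qed

instantiation signed_measure :: (topological_space) real_vector
begin

lift_definition zero_signed_measure :: "'a signed_measure" is "\<lambda>_. 0"
  by (simp add: signed_measures_def)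

lift_definition plus_signed_measure ::
    "'a signed_measure \<Rightarrow> 'a signed_measure \<Rightarrow> 'a signed_measure"
  is "\<lambda>m n A. m A + n A"
  by (auto simp: signed_measures_def intro!: sums_add)

lift_definition minus_signed_measure ::
    "'a signed_measure \<Rightarrow> 'a signed_measure \<Rightarrow> 'a signed_measure"
  is "\<lambda>m n A. m A - n A"
  by (auto simp: signed_measures_def intro!: sums_diff)

lift_definition uminus_signed_measure :: "'a signed_measure \<Rightarrow> 'a signed_measure"
  is "\<lambda>m A. - m A"
  by (auto simp: signed_measures_def intro!: sums_minus)

lift_definition scaleR_signed_measure :: "real \<Rightarrow> 'a signed_measure \<Rightarrow> 'a signed_measure"
  is "\<lambda>c m A. c * m A"
  by (auto simp: signed_measures_def intro!: sums_mult)

instance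
  by standard (transfer; simp add: fun_eq_iff algebra_simps)+

end

text \<open>
  Jordan decomposition: \<open>m\<^sup>+ A\<close> is the supremum of \<open>m B\<close> over Borel \<open>B \<subseteq> A\<close>.  As \<open>ennreal\<close> truncates
  negative values to \<open>0\<close> and \<open>m {} = 0\<close>, the truncation does not change this supremum.
\<close>

definition pos_part :: "'a::topological_space signed_measure \<Rightarrow> 'a measure" where
  "pos_part m = measure_of UNIV (sets borel)
     (\<lambda>A. SUP B\<in>{B \<in> sets borel. B \<subseteq> A}. ennreal (smeasure m B))"

definition neg_part :: "'a::topological_space signed_measure \<Rightarrow> 'a measure" where
  "neg_part m = pos_part (- m)"

lemma sets_pos_part [simp, measurable_cong]:
  "sets (pos_part (m :: 'a::topological_space signed_measure)) = sets borel"
  using sets.sigma_sets_eq[of "borel :: 'a measure"] by (simp add: pos_part_def)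

lemma sets_neg_part [simp, measurable_cong]: "sets (neg_part m) = sets borel"
  by (simp add: neg_part_def)

lemma space_pos_part [simp]: "space (pos_part m) = UNIV"
  by (simp add: pos_part_def space_measure_of_conv)

lemma space_neg_part [simp]: "space (neg_part m) = UNIV"
  by (simp add: neg_part_def)

lemma smeasure_bounded: "\<exists>C. \<forall>A. \<bar>smeasure m A\<bar> \<le> C"
proof (rule ccontr)
  assume unb: "\<not> ?thesis"
  define bad where
    "bad E \<longleftrightarrow> E \<in> sets borel \<and> (\<forall>C. \<exists>B\<in>sets borel. B \<subseteq> E \<and> \<bar>smeasure m B\<bar> > C)" for E
  have bad_UNIV: "bad UNIV"
  proof -
    have "\<exists>B\<in>sets borel. \<bar>smeasure m B\<bar> > C" for C
    proof -
      obtain A where A: "\<bar>smeasure m A\<bar> > max C 0"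
        using unb by (metis not_le)
      then have "A \<in> sets borel" using smeasure_notin by force
      with A show ?thesis by auto
    qed
    then show ?thesis by (auto simp: bad_def)
  qed
  have step: "\<exists>F. bad F \<and> F \<subseteq> E \<and> \<bar>smeasure m (E - F)\<bar> > 1" if E: "bad E" for E
  proof -
    have Em: "E \<in> sets borel" using E by (simp add: bad_def)
    obtain B where B: "B \<in> sets borel" "B \<subseteq> E" "\<bar>smeasure m B\<bar> > \<bar>smeasure m E\<bar> + 1"
      using E unfolding bad_def by blast
    have d: "smeasure m (E - B) = smeasure m E - smeasure m B"
      using Em B by (intro smeasure_Diff)
    have "bad B \<or> bad (E - B)"
    proof (rule ccontr)
      assume "\<not> ?thesis"
      then have "\<not> bad B" "\<not> bad (E - B)" by auto
      moreover have "B \<in> sets borel" "E - B \<in> sets borel" using Em B(1) by auto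
      ultimately obtain C1 C2 where
        C1: "\<And>A. A \<in> sets borel \<Longrightarrow> A \<subseteq> B \<Longrightarrow> \<bar>smeasure m A\<bar> \<le> C1" and
        C2: "\<And>A. A \<in> sets borel \<Longrightarrow> A \<subseteq> E - B \<Longrightarrow> \<bar>smeasure m A\<bar> \<le> C2"
        unfolding bad_def not_less[symmetric] by metis
      obtain A where A: "A \<in> sets borel" "A \<subseteq> E" "\<bar>smeasure m A\<bar> > C1 + C2"
        using E unfolding bad_def by blast
      have "smeasure m ((A \<inter> B) \<union> (A - B)) = smeasure m (A \<inter> B) + smeasure m (A - B)"
        using A B by (intro smeasure_Un) auto
      moreover have "(A \<inter> B) \<union> (A - B) = A" by auto
      moreover have "\<bar>smeasure m (A \<inter> B)\<bar> \<le> C1" using A B by (intro C1) auto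
      moreover have "\<bar>smeasure m (A - B)\<bar> \<le> C2" using A B by (intro C2) auto
      ultimately show False using A(3) by simp
    qed
    then show ?thesis
    proof
      assume "bad B"
      with B d show ?thesis by (intro exI[of _ B]) auto
    next
      assume "bad (E - B)"
      moreover have "\<bar>smeasure m (E - (E - B))\<bar> > 1"
        using B by (simp add: double_diff)
      ultimately show ?thesis using B by (intro exI[of _ "E - B"]) auto
    qed
  qed
  obtain F where F: "bad (F n)" "F (Suc n) \<subseteq> F n \<and> \<bar>smeasure m (F n - F (Suc n))\<bar> > 1"
    for n :: nat
  proof -
    have "\<exists>f. \<forall>n. bad (f n) \<and> (f (Suc n) \<subseteq> f n \<and> \<bar>smeasure m (f n - f (Suc n))\<bar> > 1)"
      by (rule dependent_nat_choice[where P = "\<lambda>_. bad" and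
            Q = "\<lambda>_ E F. F \<subseteq> E \<and> \<bar>smeasure m (E - F)\<bar> > 1"]) (use bad_UNIV step in blast)+
    then show ?thesis using that by blast
  qed
  have anti: "F j \<subseteq> F i" if "i \<le> j" for i j
    using lift_Suc_antimono_le[of F i j] F(2) that by blast
  have "disjoint_family (\<lambda>n. F n - F (Suc n))"
    unfolding disjoint_family_on_def
  proof (intro ballI impI)
    fix i j :: nat assume "i \<noteq> j"
    then show "(F i - F (Suc i)) \<inter> (F j - F (Suc j)) = {}"
      using anti[of "Suc i" j] anti[of "Suc j" i] by (cases "i < j") auto
  qed
  moreover have "range (\<lambda>n. F n - F (Suc n)) \<subseteq> sets borel"
    using F(1) by (auto simp: bad_def)
  ultimately have "summable (\<lambda>n. smeasure m (F n - F (Suc n)))"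
    using smeasure_sums sums_summable by blast
  then have "(\<lambda>n. smeasure m (F n - F (Suc n))) \<longlonglongrightarrow> 0"
    by (rule summable_LIMSEQ_zero)
  then have "\<forall>\<^sub>F n in sequentially. \<bar>smeasure m (F n - F (Suc n))\<bar> < 1"
    by (auto dest!: tendstoD[where e = 1] simp: dist_real_def)
  then obtain n where "\<bar>smeasure m (F n - F (Suc n))\<bar> < 1"
    using eventually_happens' sequentially_bot by blast
  with F(2)[of n] show False by simp
qed

lemma ennreal_sum_le: "ennreal (\<Sum>i<n. f i) \<le> (\<Sum>i<n. ennreal (f i))" for n :: nat
proof (induction n)
  case (Suc n)
  have "ennreal (a + b) \<le> ennreal a + ennreal b" for a b :: real
    by (cases "a \<ge> 0"; cases "b \<ge> 0")
       (auto simp: ennreal_plus[symmetric] ennreal_neg simp del: ennreal_plus intro!: ennreal_leI)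
  then have "ennreal (\<Sum>i<Suc n. f i) \<le> ennreal (\<Sum>i<n. f i) + ennreal (f n)" by simp
  also have "\<dots> \<le> (\<Sum>i<n. ennreal (f i)) + ennreal (f n)" using Suc by (intro add_mono) auto
  finally show ?case by simp
qed simp

lemma emeasure_pos_part:
  assumes "A \<in> sets borel"
  shows "emeasure (pos_part m) A = (SUP B\<in>{B \<in> sets borel. B \<subseteq> A}. ennreal (smeasure m B))"
proof -
  define u where "u A = (SUP B\<in>{B \<in> sets borel. B \<subseteq> A}. ennreal (smeasure m B))" for A
  have upper: "ennreal (smeasure m B) \<le> u A" if "B \<in> sets borel" "B \<subseteq> A" for A B
    unfolding u_def using that by (intro SUP_upper) auto
  have u_mono: "u A \<le> u B" if "A \<subseteq> B" for A B
    unfolding u_def using that by (intro SUP_subset_mono) auto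
  have u_empty: "u {} = 0"
  proof -
    have "{B \<in> sets borel. B \<subseteq> {}} = {{}::'a set}" by auto
    then show ?thesis by (simp add: u_def)
  qed
  have super: "u A + u B \<le> u (A \<union> B)" if disj: "A \<inter> B = {}" for A B
  proof -
    have 1: "ennreal (smeasure m C) + ennreal (smeasure m D) \<le> u (A \<union> B)"
      if C: "C \<in> sets borel" "C \<subseteq> A" and D: "D \<in> sets borel" "D \<subseteq> B" for C D
    proof -
      consider "smeasure m C \<le> 0" | "smeasure m D \<le> 0" | "smeasure m C \<ge> 0" "smeasure m D \<ge> 0"
        by linarith
      then show ?thesis
      proof cases
        case 1
        then show ?thesis using upper[OF D(1), of "A \<union> B"] D by (auto simp: ennreal_neg)
      next
        case 2
        then show ?thesis using upper[OF C(1), of "A \<union> B"] C by (auto simp: ennreal_neg)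
      next
        case 3
        have "ennreal (smeasure m C) + ennreal (smeasure m D) = ennreal (smeasure m (C \<union> D))"
          using C D 3 disj by (subst smeasure_Un) auto
        also have "\<dots> \<le> u (A \<union> B)" using C D by (intro upper) auto
        finally show ?thesis .
      qed
    qed
    have ne: "{B \<in> sets borel. B \<subseteq> S} \<noteq> {}" for S :: "'a set" by blast
    have 2: "ennreal (smeasure m C) + u B \<le> u (A \<union> B)" if C: "C \<in> sets borel" "C \<subseteq> A" for C
    proof -
      have "ennreal (smeasure m C) + u B =
          (SUP D\<in>{D \<in> sets borel. D \<subseteq> B}. ennreal (smeasure m C) + ennreal (smeasure m D))"
        unfolding u_def[of B] by (rule ennreal_SUP_add_right[OF ne])
      also have "\<dots> \<le> u (A \<union> B)" using 1[OF C] by (intro SUP_least) auto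
      finally show ?thesis .
    qed
    have "u A + u B = (SUP C\<in>{C \<in> sets borel. C \<subseteq> A}. ennreal (smeasure m C) + u B)"
      unfolding u_def[of A] by (rule ennreal_SUP_add_left[OF ne, symmetric])
    also have "\<dots> \<le> u (A \<union> B)" using 2 by (intro SUP_least) auto
    finally show ?thesis .
  qed
  have ca: "countably_additive (sets borel) u"
    unfolding countably_additive_def
  proof (intro allI impI antisym)
    fix A :: "nat \<Rightarrow> 'a set"
    assume A: "range A \<subseteq> sets borel" and disj: "disjoint_family A"
    show "(\<Sum>i. u (A i)) \<le> u (\<Union> (range A))"
    proof (rule suminf_le_const[OF summableI])
      fix n
      have "(\<Sum>i<n. u (A i)) \<le> u (\<Union>i<n. A i)"
      proof (induction n)
        case 0
        then show ?case by simp
      next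
        case (Suc n)
        have "(\<Union>i<n. A i) \<inter> A n = {}"
        proof -
          have "A i \<inter> A n = {}" if "i < n" for i
            using disj that by (intro disjoint_family_onD) auto
          then show ?thesis by blast
        qed
        then have "u (\<Union>i<n. A i) + u (A n) \<le> u ((\<Union>i<n. A i) \<union> A n)"
          by (rule super)
        moreover have "(\<Union>i<n. A i) \<union> A n = (\<Union>i<Suc n. A i)"
          by (auto simp: lessThan_Suc)
        ultimately have "u (\<Union>i<n. A i) + u (A n) \<le> u (\<Union>i<Suc n. A i)" by simp
        then show ?case
          unfolding sum.lessThan_Suc using add_right_mono[OF Suc, of "u (A n)"]
          by (rule order_trans[rotated])
      qed
      also have "\<dots> \<le> u (\<Union> (range A))" by (intro u_mono) auto
      finally show "(\<Sum>i<n. u (A i)) \<le> u (\<Union> (range A))" .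
    qed
    have "ennreal (smeasure m B) \<le> (\<Sum>i. u (A i))"
      if B: "B \<in> sets borel" "B \<subseteq> \<Union> (range A)" for B
    proof -
      have "(\<lambda>i. smeasure m (B \<inter> A i)) sums smeasure m (\<Union>i. B \<inter> A i)"
        using A disj B by (intro smeasure_sums) (auto simp: disjoint_family_on_def)
      moreover have "(\<Union>i. B \<inter> A i) = B" using B by auto
      ultimately have "(\<lambda>n. \<Sum>i<n. smeasure m (B \<inter> A i)) \<longlonglongrightarrow> smeasure m B"
        by (simp add: sums_def)
      then have lim: "(\<lambda>n. ennreal (\<Sum>i<n. smeasure m (B \<inter> A i))) \<longlonglongrightarrow> ennreal (smeasure m B)"
        by (rule tendsto_ennrealI)
      have "ennreal (\<Sum>i<n. smeasure m (B \<inter> A i)) \<le> (\<Sum>i. u (A i))" for n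
      proof -
        have "ennreal (\<Sum>i<n. smeasure m (B \<inter> A i)) \<le> (\<Sum>i<n. ennreal (smeasure m (B \<inter> A i)))"
          by (rule ennreal_sum_le)
        also have "\<dots> \<le> (\<Sum>i<n. u (A i))"
          using A B by (intro sum_mono upper) auto
        also have "\<dots> \<le> (\<Sum>i. u (A i))" by (intro sum_le_suminf summableI) auto
        finally show ?thesis .
      qed
      then show ?thesis by (intro LIMSEQ_le_const2[OF lim]) auto
    qed
    then show "u (\<Union> (range A)) \<le> (\<Sum>i. u (A i))"
      unfolding u_def[of "\<Union> (range A)"] by (intro SUP_least) auto
  qed
  have "pos_part m = measure_of UNIV (sets borel) u"
    by (simp add: pos_part_def u_def[abs_def])
  moreover have "sigma_algebra UNIV (sets (borel :: 'a measure))"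
    using sets.sigma_algebra_axioms[of "borel :: 'a measure"] by simp
  moreover have "positive (sets borel) u" by (simp add: positive_def u_empty)
  ultimately have "emeasure (pos_part m) A = u A"
    using ca assms by (simp add: emeasure_measure_of_sigma)
  then show ?thesis by (simp add: u_def)
qed

lemma finite_measure_pos_part: "finite_measure (pos_part m)"
proof
  obtain C where C: "\<And>A. \<bar>smeasure m A\<bar> \<le> C" using smeasure_bounded by blast
  have "emeasure (pos_part m) UNIV \<le> ennreal C"
    by (subst emeasure_pos_part)
       (auto intro!: SUP_least ennreal_leI order_trans[OF abs_ge_self C])
  then show "emeasure (pos_part m) (space (pos_part m)) \<noteq> \<infinity>"
    by (auto simp: top_unique)
qed

lemma finite_measure_neg_part: "finite_measure (neg_part m)"
  by (simp add: neg_part_def finite_measure_pos_part)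

lemma smeasure_le_pos_part:
  assumes "B \<in> sets borel" "A \<in> sets borel" "B \<subseteq> A"
  shows "smeasure m B \<le> measure (pos_part m) A"
proof -
  interpret finite_measure "pos_part m" by (rule finite_measure_pos_part)
  have "ennreal (smeasure m B) \<le> ennreal (measure (pos_part m) A)"
    unfolding emeasure_eq_measure[symmetric] emeasure_pos_part[OF assms(2)]
    using assms by (intro SUP_upper) auto
  then show ?thesis by (simp add: ennreal_le_iff)
qed

lemma pos_part_le:
  assumes "A \<in> sets borel" "\<And>B. B \<in> sets borel \<Longrightarrow> B \<subseteq> A \<Longrightarrow> smeasure m B \<le> c"
  shows "measure (pos_part m) A \<le> c"
proof -
  interpret finite_measure "pos_part m" by (rule finite_measure_pos_part)
  have "ennreal (measure (pos_part m) A) \<le> ennreal c"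
    unfolding emeasure_eq_measure[symmetric] emeasure_pos_part[OF assms(1)]
    using assms(2) by (intro SUP_least ennreal_leI) auto
  moreover have "c \<ge> 0" using assms(2)[of "{}"] by simp
  ultimately show ?thesis by (simp add: ennreal_le_iff)
qed

lemma smeasure_uminus [simp]: "smeasure (- m) A = - smeasure m A"
  by transfer simp

lemma smeasure_zero [simp]: "smeasure 0 A = 0"
  by transfer simp

lemma smeasure_add [simp]: "smeasure (m + n) A = smeasure m A + smeasure n A"
  by transfer simp

lemma smeasure_minus [simp]: "smeasure (m - n) A = smeasure m A - smeasure n A"
  by transfer simp

lemma smeasure_scaleR [simp]: "smeasure (c *\<^sub>R m) A = c * smeasure m A"
  by transfer simp

lemma smeasure_Jordan:
  assumes A: "A \<in> sets borel"
  shows "smeasure m A = measure (pos_part m) A - measure (neg_part m) A"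
proof (rule antisym)
  have "measure (neg_part m) A \<le> measure (pos_part m) A - smeasure m A"
    unfolding neg_part_def
  proof (rule pos_part_le[OF A])
    fix B :: "'a set" assume B: "B \<in> sets borel" "B \<subseteq> A"
    then have "smeasure m (A - B) \<le> measure (pos_part m) A"
      using A by (intro smeasure_le_pos_part) auto
    then show "smeasure (- m) B \<le> measure (pos_part m) A - smeasure m A"
      using A B by (simp add: smeasure_Diff)
  qed
  then show "smeasure m A \<le> measure (pos_part m) A - measure (neg_part m) A" by simp
  have "measure (pos_part m) A \<le> smeasure m A + measure (neg_part m) A"
  proof (rule pos_part_le[OF A])
    fix B :: "'a set" assume B: "B \<in> sets borel" "B \<subseteq> A"
    then have "smeasure (- m) (A - B) \<le> measure (neg_part m) A"
      unfolding neg_part_def using A by (intro smeasure_le_pos_part) auto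
    then show "smeasure m B \<le> smeasure m A + measure (neg_part m) A"
      using A B by (simp add: smeasure_Diff)
  qed
  then show "measure (pos_part m) A - measure (neg_part m) A \<le> smeasure m A" by simp
qed

lemma pos_part_scaleR:
  assumes "c \<ge> 0"
  shows "measure (pos_part (c *\<^sub>R m)) UNIV = c * measure (pos_part m) UNIV"
proof (cases "c = 0")
  case True
  then have "measure (pos_part (c *\<^sub>R m)) UNIV \<le> 0" by (intro pos_part_le) auto
  with True show ?thesis by (simp add: measure_le_0_iff)
next
  case False
  with assms have c: "c > 0" by simp
  have "measure (pos_part (c *\<^sub>R m)) UNIV \<le> c * measure (pos_part m) UNIV"
    using assms by (intro pos_part_le) (auto intro!: mult_left_mono smeasure_le_pos_part)
  moreover have "measure (pos_part m) UNIV \<le> measure (pos_part (c *\<^sub>R m)) UNIV / c"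
  proof (rule pos_part_le)
    fix B :: "'a set" assume "B \<in> sets borel"
    then have "smeasure (c *\<^sub>R m) B \<le> measure (pos_part (c *\<^sub>R m)) UNIV"
      by (intro smeasure_le_pos_part) auto
    with c show "smeasure m B \<le> measure (pos_part (c *\<^sub>R m)) UNIV / c"
      by (simp add: field_simps)
  qed auto
  ultimately show ?thesis using c by (simp add: field_simps)
qed

lemma pos_part_add:
  "measure (pos_part (m + n)) UNIV \<le> measure (pos_part m) UNIV + measure (pos_part n) UNIV"
  by (rule pos_part_le) (auto intro!: add_mono smeasure_le_pos_part)

text \<open>The total variation norm \<open>\<bar>m\<bar>(X)\<close> with \<open>\<bar>m\<bar> = m\<^sup>+ + m\<^sup>-\<close>.\<close>

instantiation signed_measure :: (topological_space) real_normed_vector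
begin

definition norm_signed_measure :: "'a signed_measure \<Rightarrow> real" where
  "norm (m :: 'a signed_measure) = measure (pos_part m) UNIV + measure (neg_part m) UNIV"

definition dist_signed_measure :: "'a signed_measure \<Rightarrow> 'a signed_measure \<Rightarrow> real" where
  "dist m n = norm (m - n :: 'a signed_measure)"

definition sgn_signed_measure :: "'a signed_measure \<Rightarrow> 'a signed_measure" where
  "sgn (m :: 'a signed_measure) = m /\<^sub>R norm m"

definition uniformity_signed_measure :: "('a signed_measure \<times> 'a signed_measure) filter" where
  "uniformity = (INF e\<in>{0<..}. principal {(m :: 'a signed_measure, n). dist m n < e})"

definition open_signed_measure :: "'a signed_measure set \<Rightarrow> bool" where
  "open (U :: 'a signed_measure set) \<longleftrightarrow> (\<forall>m\<in>U. \<forall>\<^sub>F (m', n) in uniformity. m' = m \<longrightarrow> n \<in> U)"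

instance
proof
  fix m n :: "'a signed_measure" and c :: real
  show "norm m = 0 \<longleftrightarrow> m = 0"
  proof
    assume "norm m = 0"
    then have z: "measure (pos_part m) UNIV = 0" "measure (neg_part m) UNIV = 0"
      using measure_nonneg[of "pos_part m" UNIV] measure_nonneg[of "neg_part m" UNIV]
      unfolding norm_signed_measure_def by linarith+
    show "m = 0"
    proof (rule smeasure_eqI)
      fix A :: "'a set" assume A: "A \<in> sets borel"
      have "smeasure m A \<le> 0"
        using smeasure_le_pos_part[OF A, of UNIV m] z by simp
      moreover have "smeasure (- m) A \<le> 0"
        using smeasure_le_pos_part[OF A, of UNIV "- m"] z by (simp add: neg_part_def)
      ultimately show "smeasure m A = smeasure 0 A" by simp
    qed
  next
    assume "m = 0"
    then show "norm m = 0"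
      using pos_part_scaleR[of 0 m] by (simp add: norm_signed_measure_def neg_part_def)
  qed
  show "norm (m + n) \<le> norm m + norm n"
    using pos_part_add[of m n] pos_part_add[of "- m" "- n"]
    by (simp add: norm_signed_measure_def neg_part_def)
  show "norm (c *\<^sub>R m) = \<bar>c\<bar> * norm m"
  proof (cases "c \<ge> 0")
    case True
    then show ?thesis
      using pos_part_scaleR[of c m] pos_part_scaleR[of c "- m"]
      by (simp add: norm_signed_measure_def neg_part_def algebra_simps)
  next
    case False
    then show ?thesis
      using pos_part_scaleR[of "- c" m] pos_part_scaleR[of "- c" "- m"]
      by (simp add: norm_signed_measure_def neg_part_def algebra_simps)
  qed
qed (simp_all only: dist_signed_measure_def sgn_signed_measure_def
      uniformity_signed_measure_def open_signed_measure_def)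

end

text \<open>The integral \<open>\<langle>f, m\<rangle>\<close> against a signed measure, via its Jordan decomposition.\<close>

definition pairing :: "('a::topological_space \<Rightarrow>\<^sub>C real) \<Rightarrow> 'a signed_measure \<Rightarrow> real" where
  "pairing f m = (\<integral>x. f x \<partial>pos_part m) - (\<integral>x. f x \<partial>neg_part m)"

definition strongly_sigma_additive ::
    "('v::real_normed_vector \<Rightarrow> 'w::real_normed_vector) \<Rightarrow> bool" where
  "strongly_sigma_additive T \<longleftrightarrow> linear T \<and> continuous_on UNIV T"

definition radon_adjoint ::
    "('a::topological_space signed_measure \<Rightarrow> 'b::topological_space signed_measure) \<Rightarrow>
     (('b \<Rightarrow>\<^sub>C real) \<Rightarrow> ('a \<Rightarrow>\<^sub>C real)) \<Rightarrow> bool" where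
  "radon_adjoint \<Phi> S \<longleftrightarrow> (\<forall>g m. pairing g (\<Phi> m) = pairing (S g) m)"

text \<open>Weak convergence and weak continuity are sequential notions.\<close>

definition weakly_tendsto_fun ::
    "(nat \<Rightarrow> ('a::topological_space \<Rightarrow>\<^sub>C real)) \<Rightarrow> ('a \<Rightarrow>\<^sub>C real) \<Rightarrow> bool" where
  "weakly_tendsto_fun F f \<longleftrightarrow> (\<forall>m. (\<lambda>n. pairing (F n) m) \<longlonglongrightarrow> pairing f m)"

definition weakly_tendsto_measure ::
    "(nat \<Rightarrow> 'a::topological_space signed_measure) \<Rightarrow> 'a signed_measure \<Rightarrow> bool" where
  "weakly_tendsto_measure M m \<longleftrightarrow> (\<forall>f. (\<lambda>n. pairing f (M n)) \<longlonglongrightarrow> pairing f m)"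

definition weakly_continuous_operator ::
    "(('b::topological_space \<Rightarrow>\<^sub>C real) \<Rightarrow> ('a::topological_space \<Rightarrow>\<^sub>C real)) \<Rightarrow> bool" where
  "weakly_continuous_operator S \<longleftrightarrow>
     (\<forall>G g. weakly_tendsto_fun G g \<longrightarrow> weakly_tendsto_fun (\<lambda>n. S (G n)) (S g))"

definition weakly_continuous_transfunction ::
    "('a::topological_space signed_measure \<Rightarrow> 'b::topological_space signed_measure) \<Rightarrow> bool" where
  "weakly_continuous_transfunction \<Phi> \<longleftrightarrow>
     (\<forall>M m. weakly_tendsto_measure M m \<longrightarrow> weakly_tendsto_measure (\<lambda>n. \<Phi> (M n)) (\<Phi> m))"

end

theory Submission
  imports Defs "HOL-Probability.Giry_Monad"
begin

text \<open>
  Given \<open>\<Phi>\<close>, the only candidate is \<open>S g x = \<langle>g, \<Phi> \<delta>\<^sub>x\<rangle>\<close>.  Weak continuity of \<open>\<Phi>\<close> makes \<open>S g\<close>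
  continuous, and the adjoint identity, which holds on Dirac measures, spreads to all measures because
  finitely supported measures are weakly sequentially dense.  Given \<open>S\<close>, the functional
  \<open>g \<mapsto> \<langle>S g, m\<rangle>\<close> on bounded continuous functions is continuous under bounded pointwise convergence.
  Its upper and lower parts are positive Daniell functionals, each of which is integration against a
  finite Borel measure; the difference of the two measures is \<open>\<Phi> m\<close>.  The equality of norms follows
  from \<open>\<parallel>m\<parallel> = sup {\<langle>f, m\<rangle> | \<parallel>f\<parallel> \<le> 1}\<close>.
\<close>

section \<open>Integration against signed measures\<close>

text \<open>Two obstacles make weak continuity indispensable. On a non-compact space the norm dual
  of the bounded continuous functions also contains functionals that come from no countably additive
  measure, so norm continuity of \<open>S\<close> alone yields no measure; its weak continuity, used
  on bounded sequences tending pointwise to 0, supplies Daniell's condition. In the other direction,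
  norm limits of finitely supported measures are purely atomic, so norm continuity of
  \<open>\<Phi>\<close> cannot carry the adjoint identity from Dirac measures to all measures; weak
  limits can, because a finite measure is the weak limit of its images under simple functions
  approximating the identity. The Jordan parts are not additive in the measure, so even linearity of
  \<open>pairing\<close> in its second argument needs an argument. The norm formula rests on inner
  regularity: disjoint compact sets carry almost all of the two parts, and Urysohn's lemma separates
  them.\<close>

lemma tendsto_sum_list:
  fixes f :: "'i \<Rightarrow> 'b \<Rightarrow> 'c::topological_monoid_add"
  assumes "\<And>x. x \<in> set xs \<Longrightarrow> ((\<lambda>i. f i x) \<longlongrightarrow> g x) F"
  shows "((\<lambda>i. \<Sum>x\<leftarrow>xs. f i x) \<longlongrightarrow> (\<Sum>x\<leftarrow>xs. g x)) F"
  using assms by (induction xs) (auto intro!: tendsto_add)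

text \<open>Linearity of \<open>pairing\<close> in the measure is not visible from the Jordan parts.
  It becomes an instance of this principle: a linear relation between finite measures passes to
  integrals, by induction over nonnegative Borel functions.\<close>

lemma integral_lincomb_measures_nonneg:
  fixes f :: "'a::topological_space \<Rightarrow> real" and xs :: "(real \<times> 'a measure) list"
  assumes fin: "\<And>c M. (c, M) \<in> set xs \<Longrightarrow> finite_measure M"
    and sets: "\<And>c M. (c, M) \<in> set xs \<Longrightarrow> sets M = sets borel"
    and zero: "\<And>A. A \<in> sets borel \<Longrightarrow> (\<Sum>(c, M)\<leftarrow>xs. c * measure M A) = 0"
    and f: "f \<in> borel_measurable borel" "\<And>x. 0 \<le> f x" "\<And>x. f x \<le> B"
  shows "(\<Sum>(c, M)\<leftarrow>xs. c * (\<integral>x. f x \<partial>M)) = 0"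
proof -
  have int: "integrable M g"
    if M: "(c, M) \<in> set xs" and g: "g \<in> borel_measurable borel" "\<And>x. 0 \<le> g x" "\<And>x. g x \<le> B'"
    for c M B' and g :: "'a \<Rightarrow> real"
  proof -
    interpret finite_measure M using M by (rule fin)
    show ?thesis
      using g sets[OF M]
      by (intro integrable_const_bound[where B = B']) (auto cong: measurable_cong_sets)
  qed
  \<comment> \<open>The bound is part of the induction claim and \<open>B\<close> stays arbitrary:
    the scaling case needs it for \<open>B / c\<close>, and the additive and limit cases use it for
    integrability and domination.\<close>
  have "(\<forall>x. f x \<le> B) \<longrightarrow> (\<Sum>(c, M)\<leftarrow>xs. c * (\<integral>x. f x \<partial>M)) = 0" for B
    using f(1,2)
  proof (induction f arbitrary: B rule: borel_measurable_induct_real)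
    case (set A)
    have "(\<Sum>(c, M)\<leftarrow>xs. c * (\<integral>x. indicator A x \<partial>M)) = (\<Sum>(c, M)\<leftarrow>xs. c * measure M A)"
      using set sets sets_eq_imp_space_eq[OF sets]
      by (intro arg_cong[of _ _ sum_list] map_cong) (auto simp: fin)
    with zero[OF set] show ?case by simp
  next
    case (mult u c)
    show ?case
    proof (cases "c = 0")
      case False
      have "(\<Sum>(k, M)\<leftarrow>xs. k * (\<integral>x. c * u x \<partial>M)) = c * (\<Sum>(k, M)\<leftarrow>xs. k * (\<integral>x. u x \<partial>M))"
        by (simp add: sum_list_const_mult[symmetric] case_prod_unfold mult.left_commute)
      moreover have "\<forall>x. u x \<le> B / c" if "\<forall>x. c * u x \<le> B"
        using that mult(1) False by (auto simp: field_simps)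
      ultimately show ?thesis using mult.IH[of "B / c"] by auto
    qed (simp add: case_prod_unfold)
  next
    case (add u v)
    show ?case
    proof
      assume le: "\<forall>x. v x + u x \<le> B"
      have "u x \<le> B" "v x \<le> B" for x
        using le[rule_format, of x] add(2)[of x] add(4)[of x] by linarith+
      then have u: "\<forall>x. u x \<le> B" and v: "\<forall>x. v x \<le> B" by auto
      have "(\<Sum>(c, M)\<leftarrow>xs. c * (\<integral>x. v x + u x \<partial>M)) =
          (\<Sum>(c, M)\<leftarrow>xs. c * (\<integral>x. v x \<partial>M) + c * (\<integral>x. u x \<partial>M))"
      proof (intro arg_cong[of _ _ sum_list] map_cong refl, clarify)
        fix c M assume M: "(c, M) \<in> set xs"
        have "integrable M u" "integrable M v"
          using int[OF M add(1,2)] int[OF M add(3,4)] u v by blast+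
        then show "c * (\<integral>x. v x + u x \<partial>M) = c * (\<integral>x. v x \<partial>M) + c * (\<integral>x. u x \<partial>M)"
          by (simp add: distrib_left)
      qed
      with add.IH[of B] u v show "(\<Sum>(c, M)\<leftarrow>xs. c * (\<integral>x. v x + u x \<partial>M)) = 0"
        by (simp add: case_prod_unfold sum_list_addf)
    qed
  next
    case (seq U)
    show ?case
    proof
      assume le: "\<forall>x. f x \<le> B"
      have U_le: "U i x \<le> B" for i x
      proof -
        have "U i x \<le> f x"
          using seq by (intro incseq_le) (auto simp: incseq_def le_fun_def)
        with le show ?thesis by (meson order_trans)
      qed
      have "(\<lambda>i. \<Sum>(c, M)\<leftarrow>xs. c * (\<integral>x. U i x \<partial>M)) \<longlonglongrightarrow> (\<Sum>(c, M)\<leftarrow>xs. c * (\<integral>x. f x \<partial>M))"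
      proof (rule tendsto_sum_list, clarify)
        fix c M assume M: "(c, M) \<in> set xs"
        interpret finite_measure M using M by (rule fin)
        show "(\<lambda>i. c * (\<integral>x. U i x \<partial>M)) \<longlonglongrightarrow> c * (\<integral>x. f x \<partial>M)"
        proof (intro tendsto_mult_left integral_dominated_convergence[where w = "\<lambda>_. B"])
          show "AE x in M. (\<lambda>i. U i x) \<longlonglongrightarrow> f x"
            using seq by auto
          show "AE x in M. norm (U i x) \<le> B" for i
            using seq U_le by auto
        qed (use seq f(1) sets[OF M] in \<open>auto cong: measurable_cong_sets\<close>)
      qed
      moreover have "(\<Sum>(c, M)\<leftarrow>xs. c * (\<integral>x. U i x \<partial>M)) = 0" for i
        using seq.IH[of i B] U_le by auto
      ultimately show "(\<Sum>(c, M)\<leftarrow>xs. c * (\<integral>x. f x \<partial>M)) = 0"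
        by (simp add: LIMSEQ_const_iff)
    qed
  qed
  then show ?thesis using f(3) by blast
qed

lemma borel_measurable_bcontfun [measurable]:
  "apply_bcontfun (f :: 'a::topological_space \<Rightarrow>\<^sub>C real) \<in> borel_measurable borel"
  by (intro borel_measurable_continuous_onI) simp

lemma abs_bcontfun_le: "\<bar>apply_bcontfun f x\<bar> \<le> norm (f :: 'a::topological_space \<Rightarrow>\<^sub>C real)"
  using norm_bounded[of f x] by simp

lemma integrable_bcontfun:
  fixes f :: "'a::topological_space \<Rightarrow>\<^sub>C real"
  assumes "finite_measure M" "sets M = sets borel"
  shows "integrable M f"
proof -
  interpret finite_measure M by fact
  show ?thesis
    using assms(2) abs_bcontfun_le[of f]
    by (intro integrable_const_bound[where B="norm f"]) (auto cong: measurable_cong_sets)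
qed

text \<open>Adding the constant \<open>norm f\<close> makes the integrand nonnegative; the
  correction is \<open>norm f\<close> times the combination evaluated at \<open>UNIV\<close>, which
  is 0.\<close>

lemma integral_lincomb_measures:
  fixes f :: "'a::topological_space \<Rightarrow>\<^sub>C real" and xs :: "(real \<times> 'a measure) list"
  assumes fin: "\<And>c M. (c, M) \<in> set xs \<Longrightarrow> finite_measure M"
    and sets: "\<And>c M. (c, M) \<in> set xs \<Longrightarrow> sets M = sets borel"
    and zero: "\<And>A. A \<in> sets borel \<Longrightarrow> (\<Sum>(c, M)\<leftarrow>xs. c * measure M A) = 0"
  shows "(\<Sum>(c, M)\<leftarrow>xs. c * (\<integral>x. f x \<partial>M)) = 0"
proof -
  have b: "0 \<le> f x + norm f" "f x + norm f \<le> 2 * norm f" for x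
    using abs_bcontfun_le[of f x] by linarith+
  have "(\<Sum>(c, M)\<leftarrow>xs. c * (\<integral>x. f x + norm f \<partial>M)) = 0"
    by (rule integral_lincomb_measures_nonneg[OF fin sets zero _ b]) auto
  moreover have "(\<Sum>(c, M)\<leftarrow>xs. c * (\<integral>x. f x + norm f \<partial>M)) =
      (\<Sum>(c, M)\<leftarrow>xs. c * (\<integral>x. f x \<partial>M) + norm f * (c * measure M UNIV))"
  proof (intro arg_cong[of _ _ sum_list] map_cong refl, clarify)
    fix c M assume M: "(c, M) \<in> set xs"
    interpret finite_measure M using M by (rule fin)
    show "c * (\<integral>x. f x + norm f \<partial>M) = c * (\<integral>x. f x \<partial>M) + norm f * (c * measure M UNIV)"
      using integrable_bcontfun[OF fin[OF M] sets[OF M]] sets_eq_imp_space_eq[OF sets[OF M]]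
      by (simp add: algebra_simps)
  qed
  moreover have "(\<Sum>(c, M)\<leftarrow>xs. norm f * (c * measure M UNIV)) = 0"
    using zero[of UNIV] by (simp add: case_prod_unfold sum_list_const_mult)
  ultimately show ?thesis by (simp add: case_prod_unfold sum_list_addf)
qed

text \<open>The combination of \<open>pos_part m\<close>, \<open>neg_part m\<close>,
  \<open>P\<close> and \<open>N\<close> with coefficients 1, -1, -1, 1 vanishes on Borel sets. Hence
  every presentation of \<open>m\<close> as a difference of finite measures computes the pairing,
  not only the Jordan one.\<close>

lemma pairing_eqI:
  fixes m :: "'a::topological_space signed_measure"
  assumes "finite_measure P" "finite_measure N" "sets P = sets borel" "sets N = sets borel"
    and "\<And>A. A \<in> sets borel \<Longrightarrow> smeasure m A = measure P A - measure N A"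
  shows "pairing f m = (\<integral>x. f x \<partial>P) - (\<integral>x. f x \<partial>N)"
proof -
  have "(\<Sum>(c, M)\<leftarrow>[(1, pos_part m), (-1, neg_part m), (-1, P), (1, N)]. c * (\<integral>x. f x \<partial>M)) = 0"
  proof (rule integral_lincomb_measures)
    fix A :: "'a set" assume "A \<in> sets borel"
    then show "(\<Sum>(c, M)\<leftarrow>[(1, pos_part m), (-1, neg_part m), (-1, P), (1, N)]. c * measure M A) = 0"
      using smeasure_Jordan[of A m] assms(5)[of A] by simp
  qed (auto simp: assms(1-4) finite_measure_pos_part finite_measure_neg_part)
  then show ?thesis by (simp add: pairing_def)
qed

lemma pairing_add_right: "pairing f (m + n) = pairing f m + pairing f n"
proof -
  have "(\<Sum>(c, M)\<leftarrow>[(1, pos_part (m + n)), (-1, neg_part (m + n)), (-1, pos_part m),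
      (1, neg_part m), (-1, pos_part n), (1, neg_part n)]. c * (\<integral>x. f x \<partial>M)) = 0"
  proof (rule integral_lincomb_measures)
    fix A :: "'a set" assume "A \<in> sets borel"
    then show "(\<Sum>(c, M)\<leftarrow>[(1, pos_part (m + n)), (-1, neg_part (m + n)), (-1, pos_part m),
      (1, neg_part m), (-1, pos_part n), (1, neg_part n)]. c * measure M A) = 0"
      using smeasure_Jordan[of A "m + n"] smeasure_Jordan[of A m] smeasure_Jordan[of A n] by simp
  qed (auto simp: finite_measure_pos_part finite_measure_neg_part)
  then show ?thesis by (simp add: pairing_def)
qed

lemma pairing_scaleR_right: "pairing f (a *\<^sub>R m) = a * pairing f m"
proof -
  have "(\<Sum>(c, M)\<leftarrow>[(1, pos_part (a *\<^sub>R m)), (-1, neg_part (a *\<^sub>R m)), (-a, pos_part m),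
      (a, neg_part m)]. c * (\<integral>x. f x \<partial>M)) = 0"
  proof (rule integral_lincomb_measures)
    fix A :: "'a set" assume "A \<in> sets borel"
    then show "(\<Sum>(c, M)\<leftarrow>[(1, pos_part (a *\<^sub>R m)), (-1, neg_part (a *\<^sub>R m)), (-a, pos_part m),
      (a, neg_part m)]. c * measure M A) = 0"
      using smeasure_Jordan[of A "a *\<^sub>R m"] smeasure_Jordan[of A m] by (simp add: algebra_simps)
  qed (auto simp: finite_measure_pos_part finite_measure_neg_part)
  then show ?thesis by (simp add: pairing_def algebra_simps)
qed

lemma linear_pairing_right: "linear (pairing f)"
  by (rule linearI) (simp_all add: pairing_add_right pairing_scaleR_right)

lemma linear_pairing_left: "linear (\<lambda>f. pairing f m)"
  by (rule linearI)
     (simp_all add: pairing_def integrable_bcontfun finite_measure_pos_part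
       finite_measure_neg_part algebra_simps)

lemma abs_pairing_le: "\<bar>pairing f m\<bar> \<le> norm f * norm m"
proof -
  have *: "\<bar>\<integral>x. f x \<partial>M\<bar> \<le> norm f * measure M UNIV"
    if "finite_measure M" "sets M = sets borel" for M
  proof -
    interpret finite_measure M by fact
    have "\<bar>\<integral>x. f x \<partial>M\<bar> \<le> (\<integral>x. norm f \<partial>M)"
      using integrable_bcontfun[OF that]
      by (intro order_trans[OF integral_abs_bound] integral_mono) (auto simp: abs_bcontfun_le)
    then show ?thesis
      using sets_eq_imp_space_eq[OF that(2)] by (simp add: mult.commute)
  qed
  show ?thesis
    using *[of "pos_part m"] *[of "neg_part m"]
    by (simp add: pairing_def norm_signed_measure_def finite_measure_pos_part
        finite_measure_neg_part distrib_left)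
qed

text \<open>Meaningful when both arguments are finite Borel measures: then the real-valued
  difference is countably additive, and \<open>measure\<close> is 0 off the sigma-algebra, as
  \<open>signed_measures\<close> demands.\<close>

definition diff_sm :: "'a::topological_space measure \<Rightarrow> 'a measure \<Rightarrow> 'a signed_measure" where
  "diff_sm P N = Abs_signed_measure (\<lambda>A. measure P A - measure N A)"

lemma smeasure_diff_sm:
  assumes "finite_measure P" "finite_measure N" "sets P = sets borel" "sets N = sets borel"
  shows "smeasure (diff_sm P N) A = measure P A - measure N A"
proof -
  interpret P: finite_measure P by fact
  interpret N: finite_measure N by fact
  have "(\<lambda>A. measure P A - measure N A) \<in> signed_measures"
    using assms(3,4)
    by (auto simp: signed_measures_def measure_notin_sets
        intro!: sums_diff P.finite_measure_UNION N.finite_measure_UNION)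
  then show ?thesis by (simp add: diff_sm_def Abs_signed_measure_inverse)
qed

lemma pairing_diff_sm:
  assumes "finite_measure P" "finite_measure N" "sets P = sets borel" "sets N = sets borel"
  shows "pairing f (diff_sm P N) = (\<integral>x. f x \<partial>P) - (\<integral>x. f x \<partial>N)"
  using assms by (intro pairing_eqI) (simp_all add: smeasure_diff_sm)

section \<open>Duality and weakly dense measures\<close>

text \<open>The hard half of the duality between norm and pairing. An almost optimal Hahn set
  \<open>B\<close> nearly separates the two Jordan parts; compact sets inside \<open>B\<close> and
  its complement carry almost all of them, and a continuous function equal to 1 on one and -1 on the
  other almost attains the norm.\<close>

lemma norm_signed_measure_le:
  fixes m :: "'a::polish_space signed_measure"
  assumes le: "\<And>f. pairing f m \<le> C * norm f"
  shows "norm m \<le> C"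
proof (rule field_le_epsilon)
  fix e :: real assume "e > 0"
  \<comment> \<open>\<open>K\<close> misses less than \<open>2 * d\<close> of the positive part and
    \<open>L\<close> less than \<open>2 * d\<close> of the negative part. Each loss counts twice,
    since \<open>g\<close> may have the wrong sign there, so the total error is
    \<open>8 * d\<close>.\<close>
  define d where "d = e / 8"
  have d: "d > 0" using \<open>e > 0\<close> by (simp add: d_def)
  let ?P = "pos_part m" and ?N = "neg_part m"
  interpret P: finite_measure ?P by (rule finite_measure_pos_part)
  interpret N: finite_measure ?N by (rule finite_measure_neg_part)
  have "\<exists>B\<in>sets borel. smeasure m B > measure ?P UNIV - d"
  proof (rule ccontr)
    assume "\<not> ?thesis"
    then have "measure ?P UNIV \<le> measure ?P UNIV - d"
      by (intro pos_part_le) (auto simp: not_less)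
    with d show False by simp
  qed
  then obtain B where B: "B \<in> sets borel" "smeasure m B > measure ?P UNIV - d" by blast
  have mB: "smeasure m B = measure ?P B - measure ?N B" using B(1) by (rule smeasure_Jordan)
  have inner: "\<exists>K. K \<subseteq> A \<and> compact K \<and> measure M A - d < measure M K"
    if M: "finite_measure M" "sets M = sets borel" and A: "A \<in> sets borel" for M and A :: "'a set"
  proof -
    interpret finite_measure M by fact
    \<comment> \<open>For a null set the truncation in \<open>ennreal\<close> makes both sides 0 and
      the strict inequality fails; the empty compact set serves then.\<close>
    have "ennreal (measure M A - d) < emeasure M A \<or> measure M A \<le> 0"
      using d by (auto simp: emeasure_eq_measure intro!: ennreal_lessI)
    then show ?thesis
    proof
      assume "ennreal (measure M A - d) < emeasure M A"
      then obtain K where "K \<subseteq> A" "compact K" "ennreal (measure M A - d) < emeasure M K"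
        using inner_regular[OF M(2) _ A] by (auto simp: less_SUP_iff)
      moreover have "measure M A - d < measure M K"
      proof (rule ccontr)
        assume "\<not> measure M A - d < measure M K"
        then have "ennreal (measure M K) \<le> ennreal (measure M A - d)" by (intro ennreal_leI) simp
        with calculation(3) show False unfolding emeasure_eq_measure[of K] by (meson leD)
      qed
      ultimately show ?thesis by blast
    next
      assume "measure M A \<le> 0"
      with d show ?thesis by (intro exI[of _ "{}"]) auto
    qed
  qed
  obtain K where K: "K \<subseteq> B" "compact K" "measure ?P B - d < measure ?P K"
    using inner[OF P.finite_measure_axioms sets_pos_part B(1)] by blast
  obtain L where L: "L \<subseteq> - B" "compact L" "measure ?N (- B) - d < measure ?N L"
    using inner[OF N.finite_measure_axioms sets_neg_part, of "- B"] B(1) by auto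
  have KL: "closed K" "closed L" "K \<inter> L = {}"
    using K L by (auto intro: compact_imp_closed)
  have "normal_space (euclidean :: 'a topology)"
    by (rule metrizable_imp_normal_space) (rule metrizable_space_euclidean)
  moreover have "closedin euclidean L" "closedin euclidean K" "disjnt L K"
    using KL by (auto simp: disjnt_def)
  ultimately obtain f where f: "continuous_map euclidean (top_of_set {-1..1::real}) f"
      "f ` L \<subseteq> {-1}" "f ` K \<subseteq> {1}"
    by (rule Urysohn_lemma[of _ _ _ "-1" 1]) simp_all
  have f1: "\<bar>f x\<bar> \<le> 1" for x using f(1) by (auto simp: continuous_map_in_subtopology abs_le_iff)
  have lb: "2 * indicator K x - 1 \<le> f x" and ub: "f x \<le> 1 - 2 * indicator L x" for x
    using f(2,3) f1[of x] by (auto simp: indicator_def abs_le_iff image_subset_iff)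
  have "f \<in> bcontfun"
    using f(1) f1 by (intro bcontfun_normI[where b = 1]) (auto simp: continuous_map_in_subtopology)
  then obtain g where g: "f = apply_bcontfun g" by (rule bcontfunE)
  have ng: "norm g \<le> 1" using f1 by (intro norm_bound) (simp add: g)
  \<comment> \<open>Testing with the constants 1 and -1 rules out a negative \<open>C\<close>, so
    \<open>norm g \<le> 1\<close> may be used to pass from \<open>C * norm g\<close> to
    \<open>C\<close>.\<close>
  have C: "C \<ge> 0"
  proof -
    let ?u = "const_bcontfun 1 :: 'a \<Rightarrow>\<^sub>C real"
    have "norm ?u \<ge> 1" using abs_bcontfun_le[of ?u undefined] by simp
    moreover have "pairing (- ?u) m = - pairing ?u m"
      by (rule linear_neg[OF linear_pairing_left])
    then have "0 \<le> C * norm ?u" using le[of ?u] le[of "- ?u"] by simp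
    ultimately show ?thesis by (smt (verit) mult_neg_pos)
  qed
  have [measurable]: "K \<in> sets borel" "L \<in> sets borel" using KL by auto
  have "pairing g m \<le> C * norm g" by (rule le)
  also have "\<dots> \<le> C" using C ng by (simp add: mult_left_le)
  finally have "pairing g m \<le> C" .
  moreover have "2 * measure ?P K - measure ?P UNIV \<le> (\<integral>x. g x \<partial>?P)"
  proof -
    have "(\<integral>x. 2 * indicator K x - 1 \<partial>?P) \<le> (\<integral>x. g x \<partial>?P)"
      using integrable_bcontfun[OF P.finite_measure_axioms sets_pos_part, of g] lb
      by (intro integral_mono) (simp_all add: g less_top[symmetric])
    then show ?thesis by (simp add: less_top[symmetric])
  qed
  moreover have "(\<integral>x. g x \<partial>?N) \<le> measure ?N UNIV - 2 * measure ?N L"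
  proof -
    have "(\<integral>x. g x \<partial>?N) \<le> (\<integral>x. 1 - 2 * indicator L x \<partial>?N)"
      using integrable_bcontfun[OF N.finite_measure_axioms sets_neg_part, of g] ub
      by (intro integral_mono) (simp_all add: g less_top[symmetric])
    then show ?thesis by (simp add: less_top[symmetric])
  qed
  moreover have "measure ?P B \<le> measure ?P UNIV"
    by (intro P.finite_measure_mono) auto
  moreover have "measure ?N (- B) = measure ?N UNIV - measure ?N B"
    using N.finite_measure_compl[of B] B(1) by (simp add: Compl_eq_Diff_UNIV)
  ultimately show "norm m \<le> C + e"
    using B(2) mB K(3) L(3) measure_nonneg[of ?N B]
    unfolding pairing_def norm_signed_measure_def d_def by linarith
qed

text \<open>The duality bound for the difference, with constant 0.\<close>

lemma signed_measure_eqI_pairing: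
  fixes m n :: "'a::polish_space signed_measure"
  assumes "\<And>f. pairing f m = pairing f n"
  shows "m = n"
proof -
  have "norm (m - n) \<le> 0"
    by (rule norm_signed_measure_le) (simp add: assms linear_diff[OF linear_pairing_right])
  then show ?thesis by simp
qed

section \<open>Dirac measures and weak sequential density\<close>

definition dirac_sm :: "'a::topological_space \<Rightarrow> 'a signed_measure" where
  "dirac_sm x = diff_sm (return borel x) (null_measure borel)"

lemma finite_measure_return: "finite_measure (return borel x)"
  by (intro finite_measureI) simp

lemma smeasure_dirac_sm: "A \<in> sets borel \<Longrightarrow> smeasure (dirac_sm x) A = indicator A x"
  by (simp add: dirac_sm_def smeasure_diff_sm finite_measure_return finite_measureI measure_return)

lemma pairing_dirac_sm: "pairing f (dirac_sm x) = f x"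
  by (simp add: dirac_sm_def pairing_diff_sm finite_measure_return finite_measureI integral_return)

lemma norm_dirac_sm_le: "norm (dirac_sm (x :: 'a::polish_space)) \<le> 1"
  by (rule norm_signed_measure_le) (use abs_bcontfun_le in \<open>auto simp: pairing_dirac_sm abs_le_iff\<close>)

text \<open>Dominated convergence with the constant \<open>K\<close>, which is integrable because
  both Jordan parts are finite.\<close>

lemma weakly_tendsto_funI:
  fixes f :: "'a::topological_space \<Rightarrow>\<^sub>C real" and F :: "nat \<Rightarrow> 'a \<Rightarrow>\<^sub>C real"
  assumes lim: "\<And>x. (\<lambda>n. F n x) \<longlonglongrightarrow> f x" and bd: "\<And>n. norm (F n) \<le> K"
  shows "weakly_tendsto_fun F f"
proof -
  have *: "(\<lambda>n. \<integral>x. F n x \<partial>M) \<longlonglongrightarrow> (\<integral>x. f x \<partial>M)" if "finite_measure M" "sets M = sets borel" for M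
  proof (rule integral_dominated_convergence[where w = "\<lambda>_. K"])
    show "AE x in M. norm (F n x) \<le> K" for n
      using bd[of n] norm_bounded[of "F n"] by (intro always_eventually) (meson order_trans)
  qed (use that lim in \<open>auto intro: finite_measure.integrable_const cong: measurable_cong_sets\<close>)
  show ?thesis
    unfolding weakly_tendsto_fun_def pairing_def
    by (intro allI tendsto_diff *) (simp_all add: finite_measure_pos_part finite_measure_neg_part)
qed

text \<open>Weak sequential density of finitely supported measures, phrased as an induction rule.
  Limits of sequences suffice, which matches the sequential notion of weak continuity.\<close>

lemma weak_sequential_induct [case_names dirac add scale lim]:
  fixes m :: "'a::polish_space signed_measure"
  assumes dirac: "\<And>x. Q (dirac_sm x)"
    and add: "\<And>m n. Q m \<Longrightarrow> Q n \<Longrightarrow> Q (m + n)"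
    and scale: "\<And>c m. Q m \<Longrightarrow> Q (c *\<^sub>R m)"
    and lim: "\<And>M m. (\<And>n. Q (M n)) \<Longrightarrow> weakly_tendsto_measure M m \<Longrightarrow> Q m"
  shows "Q m"
proof -
  have zero: "Q 0" using scale[OF dirac, of 0] by simp
  have sum: "Q (\<Sum>i\<in>I. g i)" if "finite I" "\<And>i. i \<in> I \<Longrightarrow> Q (g i)"
    for I :: "'a set" and g :: "'a \<Rightarrow> 'a signed_measure"
    using that by (induction I) (auto intro: zero add)
  let ?Z = "null_measure borel :: 'a measure"
  have Z: "finite_measure ?Z" by (intro finite_measureI) simp
  have pos: "Q (diff_sm M ?Z)" if M: "finite_measure M" "sets M = sets borel" for M
  proof -
    interpret finite_measure M by fact
    have sp: "space M = UNIV" using sets_eq_imp_space_eq[OF M(2)] by simp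
    \<comment> \<open>The identity is a measurable map into a separable metric space, hence a
      pointwise limit of simple functions.\<close>
    have "(\<lambda>x. x) \<in> borel_measurable M" using M(2) by (auto cong: measurable_cong_sets)
    from borel_measurable_implies_sequence_metric[OF this, of undefined]
    obtain s where s: "\<And>i. simple_function M (s i)" "\<And>x. (\<lambda>i. s i x) \<longlonglongrightarrow> x"
      by (auto simp: sp)
    have sm [measurable]: "s i \<in> borel_measurable M" for i
      using s(1) by (rule borel_measurable_simple_function)
    \<comment> \<open>The image of \<open>M\<close> under \<open>s i\<close> lives on the finite
      range of \<open>s i\<close>. It tends weakly to \<open>M\<close> because
      \<open>f (s i x)\<close> tends to \<open>f x\<close> under the bound
      \<open>norm f\<close>.\<close>
    define N where "N i = distr M borel (s i)" for i
    have N: "finite_measure (N i)" "sets (N i) = sets borel" for i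
      unfolding N_def using sm by (auto intro: finite_measure_distr)
    have "diff_sm (N i) ?Z = (\<Sum>y\<in>range (s i). measure M (s i -` {y}) *\<^sub>R dirac_sm y)" for i
    proof (rule smeasure_eqI)
      fix A :: "'a set" assume A: "A \<in> sets borel"
      have fin: "finite (range (s i))" using simple_functionD(1)[OF s(1)] by (simp add: sp)
      have meas: "s i -` {y} \<in> sets M" for y
        using simple_functionD(2)[OF s(1), of i "{y}"] by (simp add: sp)
      have "measure (N i) A = measure M (\<Union>y\<in>range (s i) \<inter> A. s i -` {y})"
        unfolding N_def using A by (auto simp: measure_distr sp intro!: arg_cong[of _ _ "measure M"])
      also have "\<dots> = (\<Sum>y\<in>range (s i) \<inter> A. measure M (s i -` {y}))"
        using fin meas by (intro finite_measure_finite_Union) (auto simp: disjoint_family_on_def)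
      finally have N_A: "measure (N i) A = \<dots>" .
      have lincomb: "smeasure (\<Sum>y\<in>Y. measure M (s i -` {y}) *\<^sub>R dirac_sm y) A =
          (\<Sum>y\<in>Y \<inter> A. measure M (s i -` {y}))" if "finite Y" for Y
        using that
      proof (induction Y)
        case (insert y Y)
        then show ?case by (cases "y \<in> A") (simp_all add: smeasure_dirac_sm A)
      qed simp
      show "smeasure (diff_sm (N i) ?Z) A =
          smeasure (\<Sum>y\<in>range (s i). measure M (s i -` {y}) *\<^sub>R dirac_sm y) A"
        unfolding lincomb[OF fin] N_A[symmetric] by (simp add: smeasure_diff_sm N Z)
    qed
    moreover have "finite (range (s i))" for i using simple_functionD(1)[OF s(1)] by (simp add: sp)
    ultimately have "Q (diff_sm (N i) ?Z)" for i by (auto intro!: sum scale dirac)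
    moreover have "weakly_tendsto_measure (\<lambda>i. diff_sm (N i) ?Z) (diff_sm M ?Z)"
      unfolding weakly_tendsto_measure_def
    proof
      fix f :: "'a \<Rightarrow>\<^sub>C real"
      have "(\<lambda>i. \<integral>x. f (s i x) \<partial>M) \<longlonglongrightarrow> (\<integral>x. f x \<partial>M)"
      proof (rule integral_dominated_convergence[where w = "\<lambda>_. norm f"])
        have "isCont f x" for x
          using continuous_on_apply_bcontfun[of UNIV f]
          unfolding continuous_on_eq_continuous_at[OF open_UNIV] by blast
        then show "AE x in M. (\<lambda>i. f (s i x)) \<longlonglongrightarrow> f x"
          using isCont_tendsto_compose[OF _ s(2)] by auto
        note [measurable_cong] = M(2)
        show "(\<lambda>x. f (s i x)) \<in> borel_measurable M" for i by measurable
        show "apply_bcontfun f \<in> borel_measurable M" by measurable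
      qed (simp_all add: abs_bcontfun_le)
      moreover have "pairing f (diff_sm (N i) ?Z) = (\<integral>x. f (s i x) \<partial>M)" for i
        using integral_distr[OF sm[of i], of f] by (simp add: pairing_diff_sm N Z) (simp add: N_def)
      ultimately show "(\<lambda>i. pairing f (diff_sm (N i) ?Z)) \<longlonglongrightarrow> pairing f (diff_sm M ?Z)"
        using M by (simp add: pairing_diff_sm Z)
    qed
    ultimately show ?thesis by (rule lim)
  qed
  have "diff_sm (pos_part m) ?Z + (-1) *\<^sub>R diff_sm (neg_part m) ?Z = m"
  proof (rule smeasure_eqI)
    fix A :: "'a set" assume "A \<in> sets borel"
    from smeasure_Jordan[OF this, of m]
    show "smeasure (diff_sm (pos_part m) ?Z + (-1) *\<^sub>R diff_sm (neg_part m) ?Z) A = smeasure m A"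
      by (simp add: smeasure_diff_sm finite_measure_pos_part finite_measure_neg_part Z)
  qed
  then show ?thesis
    using add[OF pos scale[OF pos]] finite_measure_pos_part[of m] finite_measure_neg_part[of m]
    by (metis sets_pos_part sets_neg_part)
qed

section \<open>Daniell functionals on a metric space\<close>

lemma ennreal_less_add: "a < top \<Longrightarrow> 0 < e \<Longrightarrow> a < a + ennreal e"
  by (cases a) (simp_all add: ennreal_plus[symmetric] ennreal_less_iff del: ennreal_plus)

text \<open>Plain functions instead of elements of the bounded continuous function type, so that
  minima, differences and comparisons with indicators can be written pointwise. Only the nonnegative
  cone is kept, since upper parts of functionals are additive there.\<close>

definition nonneg_bcontfun :: "('a::topological_space \<Rightarrow> real) set" where
  "nonneg_bcontfun = {f. f \<in> bcontfun \<and> (\<forall>x. 0 \<le> f x)}"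

lemma nonneg_bcontfunI:
  assumes "continuous_on UNIV f" "\<And>x. 0 \<le> f x" "\<And>x. f x \<le> B"
  shows "f \<in> nonneg_bcontfun"
  using assms by (auto simp: nonneg_bcontfun_def intro!: bcontfun_normI[where b = B])

lemma nonneg_bcontfunE:
  assumes "f \<in> nonneg_bcontfun"
  obtains B where "continuous_on UNIV f" "\<And>x. 0 \<le> f x" "\<And>x. f x \<le> B" "0 < B"
proof -
  have f: "continuous_on UNIV f" "bounded (range f)" "\<And>x. 0 \<le> f x"
    using assms by (auto simp: nonneg_bcontfun_def bcontfun_def)
  from f(2) obtain B where B: "0 < B" "\<And>x. \<bar>f x\<bar> \<le> B" by (auto simp: bounded_pos)
  then have "f x \<le> B" for x by (meson abs_ge_self order_trans)
  with f B(1) that show ?thesis by blast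
qed

lemma nonneg_bcontfun_nonneg: "f \<in> nonneg_bcontfun \<Longrightarrow> 0 \<le> f x"
  by (simp add: nonneg_bcontfun_def)

lemma nonneg_bcontfun_continuous: "f \<in> nonneg_bcontfun \<Longrightarrow> continuous_on A f"
  by (auto simp: nonneg_bcontfun_def bcontfun_def intro: continuous_on_subset)

lemma nonneg_bcontfun_const: "0 \<le> c \<Longrightarrow> (\<lambda>_. c) \<in> nonneg_bcontfun"
  by (intro nonneg_bcontfunI[where B = c]) auto

lemma nonneg_bcontfun_dominated:
  assumes "f \<in> nonneg_bcontfun" "continuous_on UNIV g" "\<And>x. 0 \<le> g x" "\<And>x. g x \<le> f x"
  shows "g \<in> nonneg_bcontfun"
  using assms by (elim nonneg_bcontfunE) (blast intro: nonneg_bcontfunI order_trans)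

lemma nonneg_bcontfun_add:
  assumes "f \<in> nonneg_bcontfun" "g \<in> nonneg_bcontfun"
  shows "(\<lambda>x. f x + g x) \<in> nonneg_bcontfun"
  using assms by (simp add: nonneg_bcontfun_def plus_cont)

lemma nonneg_bcontfun_scale:
  "0 \<le> c \<Longrightarrow> f \<in> nonneg_bcontfun \<Longrightarrow> (\<lambda>x. c * f x) \<in> nonneg_bcontfun"
  using scaleR_cont[of f c] by (simp add: nonneg_bcontfun_def)

lemma nonneg_bcontfun_sum:
  "(\<And>i. i \<in> I \<Longrightarrow> f i \<in> nonneg_bcontfun) \<Longrightarrow> (\<lambda>x. \<Sum>i\<in>I. f i x) \<in> nonneg_bcontfun"
  by (induction I rule: infinite_finite_induct)
     (simp_all add: nonneg_bcontfun_add nonneg_bcontfun_const)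

lemma nonneg_bcontfun_diff:
  assumes "f \<in> nonneg_bcontfun" "g \<in> nonneg_bcontfun" "\<And>x. g x \<le> f x"
  shows "(\<lambda>x. f x - g x) \<in> nonneg_bcontfun"
  using assms by (simp add: nonneg_bcontfun_def minus_cont)

lemma nonneg_bcontfun_min:
  assumes f: "f \<in> nonneg_bcontfun" and g: "g \<in> nonneg_bcontfun"
  shows "(\<lambda>x. min (f x) (g x)) \<in> nonneg_bcontfun"
  by (rule nonneg_bcontfun_dominated[OF f])
     (use f g in \<open>auto intro!: continuous_on_min simp: nonneg_bcontfun_continuous
       nonneg_bcontfun_nonneg\<close>)

text \<open>Cut off the multiples \<open>n\<close> times the distance to the complement at height 1;
  the distance is positive exactly on the open set.\<close>

lemma indicator_open_approx:
  fixes U :: "'a::metric_space set"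
  assumes "open U"
  obtains h where "\<And>n. h n \<in> nonneg_bcontfun" "\<And>n x. h n x \<le> indicator U x"
    "\<And>n x. h n x \<le> h (Suc n) x" "\<And>x. (\<lambda>n. h n x) \<longlonglongrightarrow> indicator U x"
\<comment> \<open>\<open>infdist\<close> from the empty set is 0 by convention, so the distance
  formula would give the zero function for \<open>UNIV\<close>.\<close>
proof (cases "U = UNIV")
  case True
  show ?thesis by (rule that[of "\<lambda>_ _. 1"]) (auto simp: True nonneg_bcontfun_const)
next
  case False
  define h where "h n x = min 1 (real n * infdist x (- U))" for n x
  have pos: "infdist x (- U) > 0" if "x \<in> U" for x
    using assms False that in_closed_iff_infdist_zero[of "- U" x] infdist_nonneg[of x "- U"]
    by (force simp: closed_def less_le)
  have zero: "infdist x (- U) = 0" if "x \<notin> U" for x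
    using that by simp
  show ?thesis
  proof (rule that[of h])
    show "h n \<in> nonneg_bcontfun" for n
      unfolding h_def
      by (rule nonneg_bcontfunI[where B = 1]) (auto intro!: continuous_intros simp: infdist_nonneg)
    show "h n x \<le> indicator U x" for n x
      by (cases "x \<in> U") (auto simp: h_def zero)
    show "h n x \<le> h (Suc n) x" for n x
      unfolding h_def by (intro min.mono mult_right_mono) (auto simp: infdist_nonneg)
    show "(\<lambda>n. h n x) \<longlonglongrightarrow> indicator U x" for x
    proof (cases "x \<in> U")
      case True
      obtain N :: nat where N: "1 / infdist x (- U) < real N" using reals_Archimedean2 by blast
      have "h n x = 1" if "n \<ge> N" for n
      proof -
        have "1 < real N * infdist x (- U)" using N pos[OF True] by (simp add: field_simps)
        also have "\<dots> \<le> real n * infdist x (- U)"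
          using that by (intro mult_right_mono) (auto simp: infdist_nonneg)
        finally show ?thesis by (simp add: h_def)
      qed
      then have "eventually (\<lambda>n. h n x = 1) sequentially"
        by (auto simp: eventually_sequentially)
      with True show ?thesis by (simp add: tendsto_eventually)
    qed (simp add: h_def zero)
  qed
qed

text \<open>A positive linear functional on the cone with Daniell's condition
  \<open>tendsto_0\<close>, which takes over the role that compact supports play in the Riesz
  representation theorem.\<close>

locale daniell =
  fixes P :: "('a::metric_space \<Rightarrow> real) \<Rightarrow> real"
  assumes nonneg: "f \<in> nonneg_bcontfun \<Longrightarrow> 0 \<le> P f"
    and add: "f \<in> nonneg_bcontfun \<Longrightarrow> g \<in> nonneg_bcontfun \<Longrightarrow> P (\<lambda>x. f x + g x) = P f + P g"
    and scale: "0 \<le> c \<Longrightarrow> f \<in> nonneg_bcontfun \<Longrightarrow> P (\<lambda>x. c * f x) = c * P f"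
    and tendsto_0: "(\<And>n. F n \<in> nonneg_bcontfun) \<Longrightarrow> (\<And>n x. F (Suc n) x \<le> F n x) \<Longrightarrow>
      (\<And>x. (\<lambda>n. F n x) \<longlonglongrightarrow> 0) \<Longrightarrow> (\<lambda>n. P (F n)) \<longlonglongrightarrow> 0"
begin

lemma diff:
  assumes "f \<in> nonneg_bcontfun" "g \<in> nonneg_bcontfun" "\<And>x. g x \<le> f x"
  shows "P (\<lambda>x. f x - g x) = P f - P g"
  using add[OF nonneg_bcontfun_diff[OF assms] assms(2)] by simp

lemma mono:
  assumes "f \<in> nonneg_bcontfun" "g \<in> nonneg_bcontfun" "\<And>x. f x \<le> g x"
  shows "P f \<le> P g"
  using diff[OF assms(2,1,3)] nonneg[OF nonneg_bcontfun_diff[OF assms(2,1,3)]] by simp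

lemma zero: "P (\<lambda>_. 0) = 0"
  using scale[of 0 "\<lambda>_. 0"] by (simp add: nonneg_bcontfun_const)

lemma const: "0 \<le> c \<Longrightarrow> P (\<lambda>_. c) = c * P (\<lambda>_. 1)"
  using scale[of c "\<lambda>_. 1"] by (simp add: nonneg_bcontfun_const)

lemma sum:
  assumes "\<And>i. i \<in> I \<Longrightarrow> f i \<in> nonneg_bcontfun"
  shows "P (\<lambda>x. \<Sum>i\<in>I. f i x) = (\<Sum>i\<in>I. P (f i))"
  using assms
  by (induction I rule: infinite_finite_induct) (simp_all add: zero add nonneg_bcontfun_sum)

lemma tendsto_incseq:
  assumes F: "\<And>n. F n \<in> nonneg_bcontfun" and f: "f \<in> nonneg_bcontfun"
    and le: "\<And>n x. F n x \<le> f x" and inc: "\<And>n x. F n x \<le> F (Suc n) x"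
    and lim: "\<And>x. (\<lambda>n. F n x) \<longlonglongrightarrow> f x"
  shows "(\<lambda>n. P (F n)) \<longlonglongrightarrow> P f"
proof -
  have "(\<lambda>n. f x - F n x) \<longlonglongrightarrow> f x - f x" for x by (intro tendsto_intros lim)
  then have "(\<lambda>n. P (\<lambda>x. f x - F n x)) \<longlonglongrightarrow> 0"
    using inc by (intro tendsto_0 nonneg_bcontfun_diff f F le) auto
  then have "(\<lambda>n. P f - (P f - P (F n))) \<longlonglongrightarrow> P f - 0"
    by (intro tendsto_intros) (simp add: diff f F le)
  then show ?thesis by simp
qed

section \<open>The outer measure of a Daniell functional\<close>

definition lower :: "'a set \<Rightarrow> ('a \<Rightarrow> real) set" where
  "lower U = {f \<in> nonneg_bcontfun. \<forall>x. f x \<le> indicator U x}"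

text \<open>The competitors only have to stay below the indicator; nothing is asked of their
  supports. Subadditivity therefore comes from monotone continuity instead of partitions of
  unity.\<close>

definition inner_content :: "'a set \<Rightarrow> ennreal" where
  "inner_content U = (SUP f\<in>lower U. ennreal (P f))"

definition outer_content :: "'a set \<Rightarrow> ennreal" where
  "outer_content A = (INF U\<in>{U. open U \<and> A \<subseteq> U}. inner_content U)"

lemma inner_content_upper: "f \<in> lower U \<Longrightarrow> ennreal (P f) \<le> inner_content U"
  unfolding inner_content_def by (rule SUP_upper)

lemma lower_mono: "U \<subseteq> V \<Longrightarrow> lower U \<subseteq> lower V"
  unfolding lower_def by (auto intro: order_trans[OF _ indicator_leI])

lemma inner_content_mono: "U \<subseteq> V \<Longrightarrow> inner_content U \<le> inner_content V"
  unfolding inner_content_def by (intro SUP_subset_mono lower_mono) auto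

lemma inner_content_UNIV: "inner_content UNIV = ennreal (P (\<lambda>_. 1))"
proof (rule antisym)
  show "inner_content UNIV \<le> ennreal (P (\<lambda>_. 1))"
    unfolding inner_content_def by (intro SUP_least ennreal_leI mono) (auto simp: lower_def nonneg_bcontfun_const)
qed (auto intro!: inner_content_upper simp: lower_def nonneg_bcontfun_const)

lemma zero_in_lower: "(\<lambda>_. 0) \<in> lower U"
  by (simp add: lower_def nonneg_bcontfun_const)

lemma inner_content_empty: "inner_content {} = 0"
proof -
  have "f = (\<lambda>_. 0)" if "f \<in> lower {}" for f
  proof
    fix x show "f x = 0"
      using that nonneg_bcontfun_nonneg[of f x] by (auto simp: lower_def intro: antisym)
  qed
  then have "lower {} = {\<lambda>_. 0}" using zero_in_lower by blast
  then show ?thesis by (simp add: inner_content_def zero)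
qed

lemma outer_content_mono: "A \<subseteq> B \<Longrightarrow> outer_content A \<le> outer_content B"
  unfolding outer_content_def by (intro INF_superset_mono) auto

lemma outer_content_open: "open U \<Longrightarrow> outer_content U = inner_content U"
  unfolding outer_content_def by (intro antisym INF_lower INF_greatest inner_content_mono) auto

lemma outer_content_le_inner_content: "open U \<Longrightarrow> A \<subseteq> U \<Longrightarrow> outer_content A \<le> inner_content U"
  unfolding outer_content_def by (intro INF_lower) auto

text \<open>A function \<open>f\<close> below the union is the increasing limit of its minima with
  finite sums of functions below the single sets, so \<open>tendsto_incseq\<close> transfers the
  finite estimate to \<open>f\<close>.\<close>

lemma inner_content_UN:
  fixes U :: "nat \<Rightarrow> 'a set"
  assumes U: "\<And>i. open (U i)"
  shows "inner_content (\<Union>i. U i) \<le> (\<Sum>i. inner_content (U i))"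
  unfolding inner_content_def[of "\<Union>i. U i"]
proof (rule SUP_least)
  fix f assume "f \<in> lower (\<Union>i. U i)"
  then have f: "f \<in> nonneg_bcontfun" "\<And>x. f x \<le> indicator (\<Union>i. U i) x" by (auto simp: lower_def)
  have "\<exists>h. (\<forall>n. h n \<in> nonneg_bcontfun) \<and> (\<forall>n x. h n x \<le> indicator (U i) x) \<and>
      (\<forall>n x. h n x \<le> h (Suc n) x) \<and> (\<forall>x. (\<lambda>n. h n x) \<longlonglongrightarrow> indicator (U i) x)" for i
    using indicator_open_approx[OF U[of i]] by metis
  then obtain h where h: "\<And>i n. h i n \<in> nonneg_bcontfun" "\<And>i n x. h i n x \<le> indicator (U i) x"
      "\<And>i n x. h i n x \<le> h i (Suc n) x" "\<And>i x. (\<lambda>n. h i n x) \<longlonglongrightarrow> indicator (U i) x"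
    by metis
  have h0: "0 \<le> h i n x" for i n x using h(1) by (rule nonneg_bcontfun_nonneg)
  \<comment> \<open>Diagonal choice: \<open>n\<close> counts both the sets used and the quality of
    the approximation. On \<open>U j\<close> the single term \<open>h j n\<close> already tends to
    1, which is at least \<open>f x\<close>.\<close>
  define F where "F n x = min (f x) (\<Sum>i<n. h i n x)" for n x
  have sum_in: "(\<lambda>x. \<Sum>i<n. h i n x) \<in> nonneg_bcontfun" for n
    using h(1) by (intro nonneg_bcontfun_sum)
  have F: "F n \<in> nonneg_bcontfun" for n
    unfolding F_def by (intro nonneg_bcontfun_min f(1) sum_in)
  have "(\<lambda>n. P (F n)) \<longlonglongrightarrow> P f"
  proof (rule tendsto_incseq[OF F f(1)])
    show "F n x \<le> f x" for n x by (simp add: F_def)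
    show "F n x \<le> F (Suc n) x" for n x
    proof -
      have "(\<Sum>i<n. h i n x) \<le> (\<Sum>i<n. h i (Suc n) x)" by (intro sum_mono h(3))
      also have "\<dots> \<le> (\<Sum>i<Suc n. h i (Suc n) x)" using h0 by simp
      finally show ?thesis unfolding F_def by (intro min.mono) auto
    qed
    show "(\<lambda>n. F n x) \<longlonglongrightarrow> f x" for x
    proof (cases "x \<in> (\<Union>i. U i)")
      case True
      then obtain j where j: "x \<in> U j" by blast
      have "f x \<le> 1" using f(2)[of x] True by simp
      moreover have "(\<lambda>n. min (f x) (h j n x)) \<longlonglongrightarrow> min (f x) (indicator (U j) x)"
        by (intro tendsto_intros h(4))
      ultimately have lim: "(\<lambda>n. min (f x) (h j n x)) \<longlonglongrightarrow> f x" using j by simp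
      have "h j n x \<le> (\<Sum>i<n. h i n x)" if "n > j" for n
        using member_le_sum[of j "{..<n}" "\<lambda>i. h i n x"] that h0 by auto
      then have "eventually (\<lambda>n. min (f x) (h j n x) \<le> F n x) sequentially"
        unfolding F_def eventually_at_top_dense
          by (intro exI[of _ j]) (auto intro: order_trans[OF min.cobounded2])
      then show ?thesis
        by (rule tendsto_sandwich[OF _ _ lim tendsto_const]) (simp add: F_def)
    next
      case False
      then have "f x = 0" using f(2)[of x] nonneg_bcontfun_nonneg[OF f(1), of x] by simp
      then have "F n x = 0" for n using h0 by (simp add: F_def sum_nonneg min_absorb1)
      with \<open>f x = 0\<close> show ?thesis by simp
    qed
  qed
  then have lim: "(\<lambda>n. ennreal (P (F n))) \<longlonglongrightarrow> ennreal (P f)" by (rule tendsto_ennrealI)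
  have "ennreal (P (F n)) \<le> (\<Sum>i. inner_content (U i))" for n
  proof -
    have "P (F n) \<le> (\<Sum>i<n. P (h i n))"
      unfolding sum[OF h(1), symmetric] by (intro mono F sum_in) (simp add: F_def)
    then have "ennreal (P (F n)) \<le> ennreal (\<Sum>i<n. P (h i n))" by (rule ennreal_leI)
    also have "\<dots> = (\<Sum>i<n. ennreal (P (h i n)))" using h(1) by (simp add: nonneg sum_ennreal)
    also have "\<dots> \<le> (\<Sum>i<n. inner_content (U i))"
      using h(1,2) by (intro sum_mono inner_content_upper) (simp add: lower_def)
    also have "\<dots> \<le> (\<Sum>i. inner_content (U i))" by (intro sum_le_suminf) auto
    finally show ?thesis .
  qed
  then show "ennreal (P f) \<le> (\<Sum>i. inner_content (U i))" by (intro LIMSEQ_le_const2[OF lim]) auto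
qed

lemma outer_content_finite: "outer_content A < top"
proof -
  have "outer_content A \<le> inner_content UNIV" by (rule outer_content_le_inner_content) auto
  then show ?thesis by (simp add: inner_content_UNIV le_less_trans)
qed

lemma outer_measure_space_outer_content: "outer_measure_space (Pow UNIV) outer_content"
  unfolding outer_measure_space_def
proof (intro conjI)
  show "positive (Pow UNIV) outer_content"
    using outer_content_open[of "{}"] by (simp add: positive_def inner_content_empty)
  show "increasing (Pow UNIV) outer_content"
    by (simp add: increasing_def outer_content_mono)
  show "countably_subadditive (Pow UNIV) outer_content"
    unfolding countably_subadditive_def
  proof (intro allI impI)
    fix A :: "nat \<Rightarrow> 'a set"
    show "outer_content (\<Union>i. A i) \<le> (\<Sum>i. outer_content (A i))"
    proof (rule ennreal_le_epsilon)
      fix e :: real assume e: "0 < e"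
      have "\<exists>U. open U \<and> A i \<subseteq> U \<and> inner_content U \<le> outer_content (A i) + ennreal (e * (1/2) ^ Suc i)" for i
      proof -
        have "outer_content (A i) < outer_content (A i) + ennreal (e * (1/2) ^ Suc i)"
          using outer_content_finite[of "A i"] e by (intro ennreal_less_add) auto
        then obtain U where "open U" "A i \<subseteq> U" "inner_content U < outer_content (A i) + ennreal (e * (1/2) ^ Suc i)"
          unfolding outer_content_def[of "A i"] by (auto simp: INF_less_iff)
        then show ?thesis by (intro exI[of _ U]) auto
      qed
      then obtain U where U: "\<And>i. open (U i)" "\<And>i. A i \<subseteq> U i"
          "\<And>i. inner_content (U i) \<le> outer_content (A i) + ennreal (e * (1/2) ^ Suc i)" by metis
      have "outer_content (\<Union>i. A i) \<le> inner_content (\<Union>i. U i)" using U by (intro outer_content_le_inner_content) auto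
      also have "\<dots> \<le> (\<Sum>i. inner_content (U i))" using U(1) by (rule inner_content_UN)
      also have "\<dots> \<le> (\<Sum>i. outer_content (A i) + ennreal (e * (1/2) ^ Suc i))"
        using U(3) by (intro suminf_le) auto
      also have "\<dots> = (\<Sum>i. outer_content (A i)) + (\<Sum>i. ennreal (e * (1/2) ^ Suc i))"
        by (intro suminf_add[symmetric]) auto
      also have "(\<Sum>i. ennreal (e * (1/2) ^ Suc i)) = ennreal e"
        using e sums_mult[OF power_half_series, of e] by (intro suminf_ennreal_eq) auto
      finally show "outer_content (\<Union>i. A i) \<le> (\<Sum>i. outer_content (A i)) + ennreal e" .
    qed
  qed
qed

text \<open>Caratheodory's inequality for open sets. A competitor for \<open>U \<inter> V\<close> is
  lowered slightly so that it lives on a closed subset \<open>K\<close>; competitors for the open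
  set \<open>V - K\<close>, which contains \<open>V - U\<close>, can then be added to it.\<close>

lemma outer_content_split_open:
  assumes "open U" "open V"
  shows "inner_content (U \<inter> V) + outer_content (V - U) \<le> inner_content V"
proof -
  have 1: "ennreal (P f) + outer_content (V - U) \<le> inner_content V" if "f \<in> lower (U \<inter> V)" for f
  proof (rule ennreal_le_epsilon)
    fix d :: real assume d: "0 < d"
    \<comment> \<open>Removing the part of \<open>f\<close> below height \<open>e\<close> costs at
      most \<open>e * P (\<lambda>_. 1)\<close>, hence at most \<open>d\<close>; the added 1
      prevents division by zero.\<close>
    define e where "e = d / (P (\<lambda>_. 1) + 1)"
    have P1: "0 \<le> P (\<lambda>_. 1)" by (intro nonneg nonneg_bcontfun_const) simp
    have e: "0 < e" "e * P (\<lambda>_. 1) \<le> d"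
      using d P1 by (auto simp: e_def field_simps)
    have f: "f \<in> nonneg_bcontfun" "\<And>x. f x \<le> indicator (U \<inter> V) x"
      using that by (auto simp: lower_def)
    define K where "K = {x. e \<le> f x}"
    have "closed K"
      unfolding K_def by (intro closed_Collect_le continuous_on_const nonneg_bcontfun_continuous f)
    have "K \<subseteq> U \<inter> V"
    proof
      fix x assume "x \<in> K"
      then have "(0::real) < indicator (U \<inter> V) x" using f(2)[of x] e(1) unfolding K_def by simp
      then show "x \<in> U \<inter> V" by (auto simp: indicator_def split: if_splits)
    qed
    \<comment> \<open>The positive part of \<open>f - e\<close>. It vanishes off \<open>K\<close>,
      while \<open>g\<close> vanishes on \<open>K\<close>, so their sum stays below the indicator of
      \<open>V\<close>.\<close>
    define f' where "f' x = f x - min (f x) e" for x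
    have min_in: "(\<lambda>x. min (f x) e) \<in> nonneg_bcontfun"
      using f(1) e(1) by (intro nonneg_bcontfun_min nonneg_bcontfun_const) auto
    have f': "f' \<in> nonneg_bcontfun"
      unfolding f'_def by (intro nonneg_bcontfun_diff f min_in) simp
    have "P (\<lambda>x. min (f x) e) \<le> P (\<lambda>_. e)"
      using e(1) by (intro mono min_in nonneg_bcontfun_const) auto
    then have Pf: "P f \<le> P f' + d"
      using diff[OF f(1) min_in] const[of e] e by (simp add: f'_def[abs_def])
    have 2: "ennreal (P f') + ennreal (P g) \<le> inner_content V" if g: "g \<in> lower (V - K)" for g
    proof -
      have g': "g \<in> nonneg_bcontfun" "\<And>x. g x \<le> indicator (V - K) x" using g by (auto simp: lower_def)
      have "f' x + g x \<le> indicator V x" for x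
      proof (cases "x \<in> K")
        case True
        then have "x \<in> V" "g x \<le> 0" "f' x \<le> 1"
          using \<open>K \<subseteq> U \<inter> V\<close> g'(2)[of x] order_trans[OF f(2) indicator_le_1, of x] e(1) nonneg_bcontfun_nonneg[OF f(1), of x]
          by (auto simp: f'_def min_def indicator_def split: if_splits)
        then show ?thesis by simp
      next
        case False
        then have "f' x = 0" by (simp add: f'_def K_def)
        then show ?thesis using g'(2)[of x] False by (simp add: indicator_def split: if_splits)
      qed
      then have "(\<lambda>x. f' x + g x) \<in> lower V"
        using f' g'(1) by (simp add: lower_def nonneg_bcontfun_add)
      then have "ennreal (P (\<lambda>x. f' x + g x)) \<le> inner_content V" by (rule inner_content_upper)
      then show ?thesis using f' g'(1) by (simp add: add nonneg)
    qed
    have "ennreal (P f') + inner_content (V - K) =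
        (SUP g\<in>lower (V - K). ennreal (P f') + ennreal (P g))"
      unfolding inner_content_def[of "V - K"] using zero_in_lower by (intro ennreal_SUP_add_right) auto
    also have "\<dots> \<le> inner_content V" using 2 by (intro SUP_least)
    finally have 3: "ennreal (P f') + inner_content (V - K) \<le> inner_content V" .
    have "outer_content (V - U) \<le> inner_content (V - K)"
      using \<open>closed K\<close> \<open>K \<subseteq> U \<inter> V\<close> assms by (intro outer_content_le_inner_content open_Diff) auto
    moreover have "ennreal (P f) \<le> ennreal (P f') + ennreal d"
      using Pf d nonneg[OF f'] by (simp add: ennreal_plus[symmetric] ennreal_leI del: ennreal_plus)
    ultimately have "ennreal (P f) + outer_content (V - U) \<le> (ennreal (P f') + ennreal d) + inner_content (V - K)"
      by (rule add_mono[rotated])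
    also have "\<dots> = (ennreal (P f') + inner_content (V - K)) + ennreal d" by (simp add: ac_simps)
    also have "\<dots> \<le> inner_content V + ennreal d" using 3 by (rule add_right_mono)
    finally show "ennreal (P f) + outer_content (V - U) \<le> inner_content V + ennreal d" .
  qed
  have "inner_content (U \<inter> V) + outer_content (V - U) = (SUP f\<in>lower (U \<inter> V). ennreal (P f) + outer_content (V - U))"
    unfolding inner_content_def[of "U \<inter> V"] using zero_in_lower by (intro ennreal_SUP_add_left[symmetric]) auto
  also have "\<dots> \<le> inner_content V" using 1 by (intro SUP_least)
  finally show ?thesis .
qed

text \<open>The inequality for open \<open>V\<close> passes to an arbitrary \<open>A\<close> by
  taking the infimum over open sets containing \<open>A\<close>; the opposite inequality is
  subadditivity.\<close>

lemma open_in_lambda_system: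
  assumes U: "open U"
  shows "U \<in> lambda_system UNIV (Pow UNIV) outer_content"
  unfolding lambda_system_def
proof (intro CollectI conjI ballI)
  fix A :: "'a set"
  interpret pow: sigma_algebra "UNIV :: 'a set" "Pow UNIV" by (rule sigma_algebra_Pow)
  have "subadditive (Pow UNIV) outer_content"
    using outer_measure_space_outer_content
    by (intro pow.countably_subadditive_subadditive) (auto simp: outer_measure_space_def)
  then have "outer_content ((U \<inter> A) \<union> ((UNIV - U) \<inter> A)) \<le> outer_content (U \<inter> A) + outer_content ((UNIV - U) \<inter> A)"
    by (rule subadditiveD) auto
  moreover have "(U \<inter> A) \<union> ((UNIV - U) \<inter> A) = A" by auto
  moreover have "outer_content (U \<inter> A) + outer_content ((UNIV - U) \<inter> A) \<le> outer_content A"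
    unfolding outer_content_def[of A]
  proof (rule INF_greatest, clarify)
    fix V assume V: "open V" "A \<subseteq> V"
    have "outer_content (U \<inter> A) + outer_content ((UNIV - U) \<inter> A) \<le> inner_content (U \<inter> V) + outer_content (V - U)"
      using U V by (intro add_mono outer_content_le_inner_content outer_content_mono) auto
    also have "\<dots> \<le> inner_content V" using U V(1) by (rule outer_content_split_open)
    finally show "outer_content (U \<inter> A) + outer_content ((UNIV - U) \<inter> A) \<le> inner_content V" .
  qed
  ultimately show "outer_content (U \<inter> A) + outer_content ((UNIV - U) \<inter> A) = outer_content A" by (intro antisym) auto
qed simp

definition M :: "'a measure" where
  "M = measure_of UNIV (sets borel) outer_content"

lemma sets_M [simp, measurable_cong]: "sets M = sets borel"
  using sets.sigma_sets_eq[of "borel :: 'a measure"] by (simp add: M_def)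

lemma space_M [simp]: "space M = UNIV"
  by (simp add: M_def space_measure_of_conv)

text \<open>Caratheodory's theorem makes \<open>outer_content\<close> a measure on a sigma-algebra
  containing the open sets, hence all Borel sets.\<close>

lemma emeasure_M:
  assumes "A \<in> sets borel"
  shows "emeasure M A = outer_content A"
proof -
  interpret pow: sigma_algebra "UNIV :: 'a set" "Pow UNIV" by (rule sigma_algebra_Pow)
  let ?L = "lambda_system UNIV (Pow UNIV) outer_content"
  have ms: "measure_space UNIV ?L outer_content"
    by (rule pow.caratheodory_lemma[OF outer_measure_space_outer_content])
  then interpret L: sigma_algebra UNIV ?L by (simp add: measure_space_def)
  have sub: "sets borel \<subseteq> ?L"
    unfolding sets_borel by (rule L.sigma_sets_subset) (blast intro: open_in_lambda_system)
  have "countably_additive (sets borel) outer_content"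
    using ms sub by (auto simp: measure_space_def countably_additive_def)
  moreover have "positive (sets borel) outer_content"
    using ms by (simp add: measure_space_def positive_def)
  moreover have "sigma_algebra UNIV (sets (borel :: 'a measure))"
    using sets.sigma_algebra_axioms[of "borel :: 'a measure"] by simp
  ultimately show ?thesis
    using assms unfolding M_def by (intro emeasure_measure_of_sigma)
qed

lemma finite_measure_M: "finite_measure M"
  using outer_content_finite[of UNIV] by (intro finite_measureI) (auto simp: emeasure_M)

section \<open>Integration against the constructed measure\<close>

lemma measure_M_UNIV: "measure M UNIV = P (\<lambda>_. 1)"
  by (simp add: measure_def emeasure_M outer_content_open inner_content_UNIV nonneg nonneg_bcontfun_const)

lemma le_measure_M:
  assumes "open U" "f \<in> lower U"
  shows "P f \<le> measure M U"
proof -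
  interpret finite_measure M by (rule finite_measure_M)
  have "ennreal (P f) \<le> emeasure M U"
    using assms by (simp add: emeasure_M outer_content_open inner_content_upper)
  then show ?thesis by (simp add: emeasure_eq_measure)
qed

lemma integrable_M:
  assumes "f \<in> nonneg_bcontfun"
  shows "integrable M f"
proof -
  interpret finite_measure M by (rule finite_measure_M)
  obtain B where "continuous_on UNIV f" "\<And>x. 0 \<le> f x" "\<And>x. f x \<le> B" "0 < B"
    by (rule nonneg_bcontfunE[OF assms]) (rule that)
  moreover from this(1) have "f \<in> borel_measurable M"
    unfolding measurable_cong_sets[OF sets_M refl] by (rule borel_measurable_continuous_onI)
  ultimately show ?thesis by (intro integrable_const_bound[where B = B]) auto
qed

text \<open>Cutting \<open>f\<close> into horizontal slices of height \<open>c\<close>, slice \<open>k\<close> lies between \<open>c\<close> times the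
  indicators of \<open>{f > (k + 1) c}\<close> and \<open>{f > k c}\<close>.\<close>

lemma le_integral_M:
  assumes f: "f \<in> nonneg_bcontfun"
  shows "P f \<le> (\<integral>x. f x \<partial>M)"
proof -
  interpret finite_measure M by (rule finite_measure_M)
  obtain B where B: "continuous_on UNIV f" "\<And>x. 0 \<le> f x" "\<And>x. f x \<le> B" "0 < B"
    by (rule nonneg_bcontfunE[OF f]) (rule that)
  have slice: "P f \<le> (\<integral>x. f x \<partial>M) + c * measure M UNIV" if c: "c = B / real n" "n > 0" for c n
  proof -
    have c0: "c > 0" using c B(4) by simp
    define u where "u k x = min (f x) (real (Suc k) * c) - min (f x) (real k * c)" for k x
    define U where "U k = {x. real k * c < f x}" for k
    have min_in: "(\<lambda>x. min (f x) (real k * c)) \<in> nonneg_bcontfun" for k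
      using c0 by (intro nonneg_bcontfun_min f nonneg_bcontfun_const) auto
    have u: "u k \<in> nonneg_bcontfun" for k
      unfolding u_def using c0 by (intro nonneg_bcontfun_diff min_in min.mono) auto
    have openU: "open (U k)" for k
      unfolding U_def by (intro open_Collect_less B continuous_on_const)
    then have [measurable]: "U k \<in> sets borel" for k by auto
    have u_le: "u k x \<le> c * indicator (U k) x" and le_u: "c * indicator (U (Suc k)) x \<le> u k x" for k x
      using c0 by (auto simp: u_def U_def indicator_def min_def algebra_simps)
    have sum_u: "(\<Sum>k<n. u k x) = f x" for x
    proof -
      have "(\<Sum>k<m. u k x) = min (f x) (real m * c)" for m
        using B(2)[of x] by (induction m) (simp_all add: u_def)
      then show ?thesis using B(3)[of x] c by simp
    qed
    have int_U: "integrable M (\<lambda>x. c * indicator (U k) x)" for k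
      by (simp add: less_top[symmetric])
    have Pu: "P (u k) \<le> c * measure M (U k)" for k
    proof -
      have "(\<lambda>x. (1 / c) * u k x) \<in> lower (U k)"
        using c0 u_le[of k] u[of k]
        by (auto simp: lower_def field_simps intro!: nonneg_bcontfun_scale[of "1 / c", simplified])
      from le_measure_M[OF openU this] have "P (u k) / c \<le> measure M (U k)"
        using scale[OF _ u, of "1 / c" k] c0 by simp
      then show ?thesis using c0 by (simp add: pos_divide_le_eq mult.commute)
    qed
    have "P f = (\<Sum>k<n. P (u k))" using sum[of "{..<n}" u] u by (simp add: sum_u)
    also have "\<dots> \<le> (\<Sum>k<n. c * measure M (U k))" by (intro sum_mono Pu)
    also have "\<dots> = (\<Sum>k<n. \<integral>x. c * indicator (U k) x \<partial>M)" by simp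
    also have "\<dots> = (\<integral>x. (\<Sum>k<n. c * indicator (U k) x) \<partial>M)"
      by (rule Bochner_Integration.integral_sum[symmetric]) (rule int_U)
    also have "\<dots> \<le> (\<integral>x. f x + c \<partial>M)"
    proof (rule integral_mono)
      fix x
      \<comment> \<open>The extra term allows an index shift: \<open>U 0\<close> costs at most
        \<open>c\<close>, and \<open>U (Suc k)\<close> is paid for by slice \<open>u k\<close>. This
        \<open>c\<close> is the whole pointwise error and disappears as \<open>n\<close>
        grows.\<close>
      have "(\<Sum>k<n. c * indicator (U k) x) \<le> (\<Sum>k<Suc n. c * indicator (U k) x)"
        using c0 by simp
      also have "\<dots> = c * indicator (U 0) x + (\<Sum>k<n. c * indicator (U (Suc k)) x)"
        by (rule sum.lessThan_Suc_shift)
      also have "\<dots> \<le> c + (\<Sum>k<n. u k x)"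
        using c0 by (intro add_mono sum_mono le_u) (auto simp: indicator_def)
      finally show "(\<Sum>k<n. c * indicator (U k) x) \<le> f x + c" by (simp add: sum_u)
    qed (intro Bochner_Integration.integrable_sum Bochner_Integration.integrable_add int_U
        integrable_M f integrable_const)+
    also have "\<dots> = (\<integral>x. f x \<partial>M) + c * measure M UNIV"
      by (simp add: integrable_M f mult.commute)
    finally show ?thesis .
  qed
  have "(\<lambda>n. (\<integral>x. f x \<partial>M) + B / real n * measure M UNIV) \<longlonglongrightarrow> (\<integral>x. f x \<partial>M) + 0 * measure M UNIV"
    by (intro tendsto_intros lim_const_over_n)
  then show ?thesis
    using slice by (intro LIMSEQ_le_const[of _ _ "P f"]) (auto intro!: exI[of _ 1])
qed

text \<open>The one-sided estimate applied to \<open>B - f\<close> gives the reverse inequality,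
  because \<open>P\<close> and the integral agree on constants.\<close>

lemma integral_M:
  assumes f: "f \<in> nonneg_bcontfun"
  shows "(\<integral>x. f x \<partial>M) = P f"
proof (rule antisym[OF _ le_integral_M[OF f]])
  interpret finite_measure M by (rule finite_measure_M)
  obtain B where B: "continuous_on UNIV f" "\<And>x. 0 \<le> f x" "\<And>x. f x \<le> B" "0 < B"
    by (rule nonneg_bcontfunE[OF f]) (rule that)
  have cB: "(\<lambda>_. B) \<in> nonneg_bcontfun" using B(4) by (intro nonneg_bcontfun_const) simp
  have "P (\<lambda>x. B - f x) \<le> (\<integral>x. B - f x \<partial>M)"
    by (intro le_integral_M nonneg_bcontfun_diff cB f B(3))
  moreover have "P (\<lambda>x. B - f x) = B * measure M UNIV - P f"
    using diff[OF cB f B(3)] const[of B] B(4) by (simp add: measure_M_UNIV)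
  moreover have "(\<integral>x. B - f x \<partial>M) = B * measure M UNIV - (\<integral>x. f x \<partial>M)"
    by (simp add: integrable_M f mult.commute)
  ultimately show "(\<integral>x. f x \<partial>M) \<le> P f" by simp
qed

end

section \<open>Radon adjoints\<close>

lemma strongly_sigma_additive_iff: "strongly_sigma_additive T \<longleftrightarrow> bounded_linear T"
proof
  assume "strongly_sigma_additive T"
  then have lin: "linear T" and cont: "continuous_on UNIV T"
    by (auto simp: strongly_sigma_additive_def)
  have "isCont T 0" using cont by (simp add: continuous_on_eq_continuous_at)
  then obtain d where d: "d > 0" "\<And>x. norm x < d \<Longrightarrow> norm (T x) < 1"
    using linear_0[OF lin] unfolding continuous_at_eps_delta
    by (metis diff_zero dist_norm zero_less_one)
  \<comment> \<open>A nonzero \<open>x\<close> rescaled to length \<open>d / 2\<close> lies in the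
    ball on which \<open>norm (T x) < 1\<close>; this yields the constant
    \<open>2 / d\<close>.\<close>
  show "bounded_linear T"
  proof (rule bounded_linear_intro[where K = "2 / d"])
    show "T (x + y) = T x + T y" "T (r *\<^sub>R x) = r *\<^sub>R T x" for x y r
      by (rule linear_add[OF lin] linear_scale[OF lin])+
    show "norm (T x) \<le> norm x * (2 / d)" for x
    proof (cases "x = 0")
      case False
      then have "norm ((d / (2 * norm x)) *\<^sub>R x) < d" using d(1) by simp
      from d(2)[OF this] have "d / (2 * norm x) * norm (T x) < 1"
        using d(1) by (simp add: linear_scale[OF lin])
      with d(1) False show ?thesis by (simp add: field_simps)
    qed (simp add: linear_0[OF lin])
  qed
next
  assume "bounded_linear T"
  then show "strongly_sigma_additive T"
    by (simp add: strongly_sigma_additive_def bounded_linear.linear linear_continuous_on)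
qed

section \<open>Order decomposition of functionals on bounded continuous functions\<close>

lemma apply_Bcontfun: "f \<in> nonneg_bcontfun \<Longrightarrow> apply_bcontfun (Bcontfun f) = f"
  by (simp add: nonneg_bcontfun_def Bcontfun_inverse)

lemma Bcontfun_add:
  "f \<in> nonneg_bcontfun \<Longrightarrow> g \<in> nonneg_bcontfun \<Longrightarrow>
    Bcontfun (\<lambda>x. f x + g x) = Bcontfun f + Bcontfun g"
  by (rule bcontfun_eqI) (simp add: apply_Bcontfun nonneg_bcontfun_add)

lemma Bcontfun_scaleR:
  "0 \<le> c \<Longrightarrow> f \<in> nonneg_bcontfun \<Longrightarrow> Bcontfun (\<lambda>x. c * f x) = c *\<^sub>R Bcontfun f"
  by (rule bcontfun_eqI) (simp add: apply_Bcontfun nonneg_bcontfun_scale)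

lemma Bcontfun_zero: "Bcontfun (\<lambda>_. 0) = (0 :: 'a::topological_space \<Rightarrow>\<^sub>C real)"
  by (rule bcontfun_eqI) (simp add: apply_Bcontfun nonneg_bcontfun_const)

lemma norm_Bcontfun_le:
  assumes "f \<in> nonneg_bcontfun" "\<And>x. f x \<le> B"
  shows "norm (Bcontfun f) \<le> B"
  using assms by (intro norm_bound) (simp add: apply_Bcontfun nonneg_bcontfun_nonneg)

text \<open>The Riesz formula for the positive part of \<open>L\<close> in the order dual, the
  counterpart for functionals of \<open>pos_part\<close>.\<close>

definition upper_part :: "(('a::topological_space \<Rightarrow>\<^sub>C real) \<Rightarrow> real) \<Rightarrow> ('a \<Rightarrow> real) \<Rightarrow> real" where
  "upper_part L f = (SUP g\<in>{g \<in> nonneg_bcontfun. \<forall>x. g x \<le> f x}. L (Bcontfun g))"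

text \<open>Continuity is required along all bounded pointwise null sequences, not only decreasing
  ones: the near-maximisers in \<open>upper_part_tendsto_0\<close> are dominated by a decreasing
  sequence but need not decrease.\<close>

locale sequential_functional = bounded_linear L
  for L :: "('a::metric_space \<Rightarrow>\<^sub>C real) \<Rightarrow> real" +
  assumes tendsto_0: "(\<And>x. (\<lambda>n. apply_bcontfun (G n) x) \<longlonglongrightarrow> 0) \<Longrightarrow>
    (\<And>n. norm (G n) \<le> K) \<Longrightarrow> (\<lambda>n. L (G n)) \<longlonglongrightarrow> 0"
begin

abbreviation below :: "('a \<Rightarrow> real) \<Rightarrow> ('a \<Rightarrow> real) set" where
  "below f \<equiv> {g \<in> nonneg_bcontfun. \<forall>x. g x \<le> f x}"

lemma zero_below: "f \<in> nonneg_bcontfun \<Longrightarrow> (\<lambda>_. 0) \<in> below f"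
  by (simp add: nonneg_bcontfun_const nonneg_bcontfun_nonneg)

lemma upper_part_upper:
  assumes f: "f \<in> nonneg_bcontfun" and g: "g \<in> nonneg_bcontfun" "\<And>x. g x \<le> f x"
  shows "L (Bcontfun g) \<le> upper_part L f"
proof -
  obtain B where B: "continuous_on UNIV f" "\<And>x. 0 \<le> f x" "\<And>x. f x \<le> B" "0 < B"
    by (rule nonneg_bcontfunE[OF f]) (rule that)
  obtain K where K: "K > 0" "\<And>x. norm (L x) \<le> norm x * K" using pos_bounded by blast
  have "L (Bcontfun h) \<le> B * K" if "h \<in> below f" for h
  proof -
    have "h x \<le> B" for x using that B(3)[of x] by (auto intro: order_trans)
    then have "norm (Bcontfun h) \<le> B" using that by (intro norm_Bcontfun_le) auto
    then have "norm (Bcontfun h) * K \<le> B * K" using K(1) by (intro mult_right_mono) auto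
    with K(2)[of "Bcontfun h"] show ?thesis by simp
  qed
  then have "bdd_above ((\<lambda>g. L (Bcontfun g)) ` below f)" by (intro bdd_aboveI2)
  then show ?thesis unfolding upper_part_def using g by (intro cSUP_upper) auto
qed

lemma upper_part_least:
  assumes "f \<in> nonneg_bcontfun"
    and "\<And>g. g \<in> nonneg_bcontfun \<Longrightarrow> (\<And>x. g x \<le> f x) \<Longrightarrow> L (Bcontfun g) \<le> c"
  shows "upper_part L f \<le> c"
  unfolding upper_part_def using zero_below[OF assms(1)] assms(2) by (intro cSUP_least) auto

text \<open>Riesz decomposition: a function \<open>h\<close> between 0 and \<open>f + g\<close>
  splits into \<open>min h f\<close>, which is below \<open>f\<close>, and a remainder below
  \<open>g\<close>. The other inequality adds competitors.\<close>

lemma upper_part_add: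
  assumes f: "f \<in> nonneg_bcontfun" and g: "g \<in> nonneg_bcontfun"
  shows "upper_part L (\<lambda>x. f x + g x) = upper_part L f + upper_part L g"
proof (rule antisym)
  note fg = nonneg_bcontfun_add[OF f g]
  show "upper_part L (\<lambda>x. f x + g x) \<le> upper_part L f + upper_part L g"
  proof (rule upper_part_least[OF fg])
    fix h assume h: "h \<in> nonneg_bcontfun" "\<And>x. h x \<le> f x + g x"
    define u where "u x = min (h x) (f x)" for x
    define v where "v x = h x - u x" for x
    have u: "u \<in> nonneg_bcontfun" unfolding u_def by (intro nonneg_bcontfun_min h f)
    have v: "v \<in> nonneg_bcontfun"
      unfolding v_def by (intro nonneg_bcontfun_diff h u) (simp add: u_def)
    have "v x \<le> g x" for x
      using h(2)[of x] nonneg_bcontfun_nonneg[OF g, of x] by (simp add: v_def u_def min_def)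
    then have "L (Bcontfun u) + L (Bcontfun v) \<le> upper_part L f + upper_part L g"
      by (intro add_mono upper_part_upper f g u v) (simp add: u_def)
    moreover have "L (Bcontfun h) = L (Bcontfun u) + L (Bcontfun v)"
      using Bcontfun_add[OF u v] by (simp add: v_def add)
    ultimately show "L (Bcontfun h) \<le> upper_part L f + upper_part L g" by simp
  qed
  have "upper_part L f \<le> upper_part L (\<lambda>x. f x + g x) - upper_part L g"
  proof (rule upper_part_least[OF f])
    fix u assume u: "u \<in> nonneg_bcontfun" "\<And>x. u x \<le> f x"
    have "upper_part L g \<le> upper_part L (\<lambda>x. f x + g x) - L (Bcontfun u)"
    proof (rule upper_part_least[OF g])
      fix v assume v: "v \<in> nonneg_bcontfun" "\<And>x. v x \<le> g x"
      have "L (Bcontfun (\<lambda>x. u x + v x)) \<le> upper_part L (\<lambda>x. f x + g x)"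
        by (intro upper_part_upper fg nonneg_bcontfun_add u v add_mono)
      then show "L (Bcontfun v) \<le> upper_part L (\<lambda>x. f x + g x) - L (Bcontfun u)"
        by (simp add: Bcontfun_add u v add)
    qed
    then show "L (Bcontfun u) \<le> upper_part L (\<lambda>x. f x + g x) - upper_part L g" by simp
  qed
  then show "upper_part L f + upper_part L g \<le> upper_part L (\<lambda>x. f x + g x)" by simp
qed

lemma upper_part_scale:
  assumes c: "0 \<le> c" and f: "f \<in> nonneg_bcontfun"
  shows "upper_part L (\<lambda>x. c * f x) = c * upper_part L f"
proof (cases "c = 0")
  case True
  have "g = (\<lambda>_. 0)" if "g \<in> nonneg_bcontfun" "\<forall>x. g x \<le> 0" for g :: "'a \<Rightarrow> real"
    using that by (intro ext antisym) (auto simp: nonneg_bcontfun_nonneg)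
  then have "below (\<lambda>_. 0) = {\<lambda>_. 0}" by (auto simp: nonneg_bcontfun_const)
  then show ?thesis by (simp add: True upper_part_def Bcontfun_zero local.zero)
next
  case False
  with c have c: "0 < c" by simp
  have cf: "(\<lambda>x. c * f x) \<in> nonneg_bcontfun" using c by (intro nonneg_bcontfun_scale f) simp
  have "upper_part L (\<lambda>x. c * f x) \<le> c * upper_part L f"
  proof (rule upper_part_least[OF cf])
    fix g assume g: "g \<in> nonneg_bcontfun" "\<And>x. g x \<le> c * f x"
    have "L (Bcontfun (\<lambda>x. (1 / c) * g x)) \<le> upper_part L f"
    proof (rule upper_part_upper[OF f])
      show "(\<lambda>x. (1 / c) * g x) \<in> nonneg_bcontfun"
        using c by (intro nonneg_bcontfun_scale g) simp
      show "(1 / c) * g x \<le> f x" for x using g(2)[of x] c by (simp add: field_simps)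
    qed
    moreover have "Bcontfun (\<lambda>x. (1 / c) * g x) = (1 / c) *\<^sub>R Bcontfun g"
      using c by (intro Bcontfun_scaleR g) simp
    ultimately have "L (Bcontfun g) / c \<le> upper_part L f" by (simp add: scaleR)
    then show "L (Bcontfun g) \<le> c * upper_part L f"
      using c by (simp add: pos_divide_le_eq mult.commute)
  qed
  moreover have "upper_part L f \<le> upper_part L (\<lambda>x. c * f x) / c"
  proof (rule upper_part_least[OF f])
    fix g assume g: "g \<in> nonneg_bcontfun" "\<And>x. g x \<le> f x"
    have "L (Bcontfun (\<lambda>x. c * g x)) \<le> upper_part L (\<lambda>x. c * f x)"
      using c g by (intro upper_part_upper cf nonneg_bcontfun_scale mult_left_mono) auto
    then show "L (Bcontfun g) \<le> upper_part L (\<lambda>x. c * f x) / c"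
      using c g by (simp add: Bcontfun_scaleR scaleR pos_le_divide_eq mult.commute)
  qed
  ultimately show ?thesis using c by (intro antisym) (simp_all add: pos_le_divide_eq mult.commute)
qed

text \<open>Pick \<open>g n\<close> below \<open>F n\<close> reaching the supremum up to
  \<open>1 / (n + 1)\<close>. These functions are squeezed to 0 pointwise and bounded by a bound of
  \<open>F 0\<close>, so \<open>L\<close> tends to 0 along them.\<close>

lemma upper_part_tendsto_0:
  assumes F: "\<And>n. F n \<in> nonneg_bcontfun" and dec: "\<And>n x. F (Suc n) x \<le> F n x"
    and lim: "\<And>x. (\<lambda>n. F n x) \<longlonglongrightarrow> 0"
  shows "(\<lambda>n. upper_part L (F n)) \<longlonglongrightarrow> 0"
proof -
  have "\<exists>g. g \<in> nonneg_bcontfun \<and> (\<forall>x. g x \<le> F n x) \<and>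
      upper_part L (F n) - inverse (real (Suc n)) < L (Bcontfun g)" for n
  proof (rule ccontr)
    assume "\<not> ?thesis"
    then have "upper_part L (F n) \<le> upper_part L (F n) - inverse (real (Suc n))"
      by (intro upper_part_least[OF F]) (auto simp: not_less)
    then show False by simp
  qed
  then obtain g where g: "\<And>n. g n \<in> nonneg_bcontfun" "\<And>n x. g n x \<le> F n x"
      "\<And>n. upper_part L (F n) - inverse (real (Suc n)) < L (Bcontfun (g n))" by metis
  obtain B where B: "continuous_on UNIV (F 0)" "\<And>x. 0 \<le> F 0 x" "\<And>x. F 0 x \<le> B" "0 < B"
    by (rule nonneg_bcontfunE[OF F[of 0]]) (rule that)
  have g_B: "g n x \<le> B" for n x
  proof -
    have "F n x \<le> F 0 x"
    proof (induction n)
      case (Suc n)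
      then show ?case using dec[of n x] by simp
    qed simp
    with g(2)[of n x] B(3)[of x] show ?thesis by simp
  qed
  have "(\<lambda>n. L (Bcontfun (g n))) \<longlonglongrightarrow> 0"
  proof (rule tendsto_0[where K = B])
    show "norm (Bcontfun (g n)) \<le> B" for n by (intro norm_Bcontfun_le g g_B)
    show "(\<lambda>n. apply_bcontfun (Bcontfun (g n)) x) \<longlonglongrightarrow> 0" for x
      unfolding apply_Bcontfun[OF g(1)]
      by (rule tendsto_sandwich[OF _ _ tendsto_const lim[of x]])
         (simp_all add: g(1,2) nonneg_bcontfun_nonneg)
  qed
  from tendsto_add[OF this LIMSEQ_inverse_real_of_nat]
  have lim0: "(\<lambda>n. L (Bcontfun (g n)) + inverse (real (Suc n))) \<longlonglongrightarrow> 0" by simp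
  have lower: "0 \<le> upper_part L (F n)" for n
    using upper_part_upper[OF F, of "\<lambda>_. 0" n] F
    by (simp add: nonneg_bcontfun_const nonneg_bcontfun_nonneg Bcontfun_zero local.zero)
  have upper: "upper_part L (F n) \<le> L (Bcontfun (g n)) + inverse (real (Suc n))" for n
    using g(3)[of n] by simp
  show ?thesis
    by (rule tendsto_sandwich[OF always_eventually always_eventually tendsto_const lim0])
       (use lower upper in blast)+
qed

lemma daniell_upper_part: "daniell (upper_part L)"
proof
  show "0 \<le> upper_part L f" if "f \<in> nonneg_bcontfun" for f
    using upper_part_upper[OF that, of "\<lambda>_. 0"] that
    by (simp add: nonneg_bcontfun_const nonneg_bcontfun_nonneg Bcontfun_zero local.zero)
qed (fact upper_part_add upper_part_scale upper_part_tendsto_0)+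

lemma sequential_functional_uminus: "sequential_functional (\<lambda>g. - L g)"
proof (intro sequential_functional.intro sequential_functional_axioms.intro)
  show "bounded_linear (\<lambda>g. - L g)" by (rule bounded_linear_minus) (rule bounded_linear_axioms)
  show "(\<lambda>n. - L (G n)) \<longlonglongrightarrow> 0"
    if "\<And>x. (\<lambda>n. apply_bcontfun (G n) x) \<longlonglongrightarrow> 0" "\<And>n. norm (G n) \<le> K" for G K
    using tendsto_minus[OF tendsto_0[OF that]] by simp
qed

text \<open>The map sending \<open>g\<close> to \<open>f - g\<close> is an involution of the
  functions between 0 and \<open>f\<close>, and it turns \<open>L g\<close> into
  \<open>L f - L g\<close>; thus it exchanges the suprema for \<open>L\<close> and
  \<open>- L\<close> up to the constant \<open>L f\<close>.\<close>

lemma upper_part_Jordan: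
  assumes f: "f \<in> nonneg_bcontfun"
  shows "L (Bcontfun f) = upper_part L f - upper_part (\<lambda>g. - L g) f"
proof -
  interpret neg: sequential_functional "\<lambda>g. - L g" by (rule sequential_functional_uminus)
  have d: "L (Bcontfun f) = L (Bcontfun g) + L (Bcontfun (\<lambda>x. f x - g x))"
      and in_d: "(\<lambda>x. f x - g x) \<in> nonneg_bcontfun"
    if g: "g \<in> nonneg_bcontfun" "\<And>x. g x \<le> f x" for g
  proof -
    show *: "(\<lambda>x. f x - g x) \<in> nonneg_bcontfun" by (rule nonneg_bcontfun_diff[OF f g])
    show "L (Bcontfun f) = L (Bcontfun g) + L (Bcontfun (\<lambda>x. f x - g x))"
      using Bcontfun_add[OF g(1) *] by (simp add: add)
  qed
  have "upper_part L f \<le> L (Bcontfun f) + upper_part (\<lambda>g. - L g) f"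
  proof (rule upper_part_least[OF f])
    fix g assume g: "g \<in> nonneg_bcontfun" "\<And>x. g x \<le> f x"
    from neg.upper_part_upper[OF f in_d[OF g]]
    show "L (Bcontfun g) \<le> L (Bcontfun f) + upper_part (\<lambda>g. - L g) f"
      using d[OF g] g(1) by (simp add: nonneg_bcontfun_nonneg)
  qed
  moreover have "upper_part (\<lambda>g. - L g) f \<le> upper_part L f - L (Bcontfun f)"
  proof (rule neg.upper_part_least[OF f])
    fix g assume g: "g \<in> nonneg_bcontfun" "\<And>x. g x \<le> f x"
    from upper_part_upper[OF f in_d[OF g]]
    show "- L (Bcontfun g) \<le> upper_part L f - L (Bcontfun f)"
      using d[OF g] g(1) by (simp add: nonneg_bcontfun_nonneg)
  qed
  ultimately show ?thesis by simp
qed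

lemma representation: "\<exists>m. \<forall>g. pairing g m = L g"
proof -
  interpret neg: sequential_functional "\<lambda>g. - L g" by (rule sequential_functional_uminus)
  interpret P: daniell "upper_part L" by (rule daniell_upper_part)
  interpret N: daniell "upper_part (\<lambda>g. - L g)" by (rule neg.daniell_upper_part)
  let ?m = "diff_sm P.M N.M"
  have pairing_m: "pairing g ?m = (\<integral>x. g x \<partial>P.M) - (\<integral>x. g x \<partial>N.M)" for g
    by (simp add: pairing_diff_sm P.finite_measure_M N.finite_measure_M)
  have pos: "pairing (Bcontfun f) ?m = L (Bcontfun f)" if "f \<in> nonneg_bcontfun" for f
    using that
    by (simp add: pairing_m apply_Bcontfun P.integral_M N.integral_M upper_part_Jordan)
  have "pairing g ?m = L g" for g
  proof -
    \<comment> \<open>The representation is known on the cone only; \<open>g\<close> is the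
      difference of \<open>g + norm g\<close> and the constant \<open>norm g\<close>, both in the
      cone.\<close>
    define c where "c = (\<lambda>_ :: 'a. norm g)"
    define h where "h x = g x + norm g" for x
    have h: "h \<in> nonneg_bcontfun"
    proof -
      have "0 \<le> g x + norm g" "g x + norm g \<le> 2 * norm g" for x
        using abs_bcontfun_le[of g x] by linarith+
      then show ?thesis
        unfolding h_def
        by (intro nonneg_bcontfunI[where B = "2 * norm g"] continuous_on_add continuous_on_const
            continuous_on_apply_bcontfun)
    qed
    have c: "c \<in> nonneg_bcontfun" unfolding c_def by (intro nonneg_bcontfun_const) simp
    have g: "g = Bcontfun h - Bcontfun c"
      by (rule bcontfun_eqI) (simp add: apply_Bcontfun h c, simp add: h_def c_def)
    have "pairing g ?m = pairing (Bcontfun h) ?m - pairing (Bcontfun c) ?m"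
      by (subst g) (rule linear_diff[OF linear_pairing_left])
    also have "\<dots> = L g" using g by (simp add: pos h c diff)
    finally show ?thesis .
  qed
  then show ?thesis by blast
qed

end

section \<open>Adjoint pairs: weak continuity, norms and existence\<close>

lemma pairing_bounded_linear_left: "bounded_linear (\<lambda>g. pairing g m)"
  by (rule bounded_linear_intro[where K = "norm m"])
     (use abs_pairing_le in \<open>simp_all add: linear_add[OF linear_pairing_left] linear_scale[OF linear_pairing_left]\<close>)

lemma radon_adjoint_pairing: "radon_adjoint \<Phi> S \<Longrightarrow> pairing g (\<Phi> m) = pairing (S g) m"
  by (simp add: radon_adjoint_def)

text \<open>Testing \<open>S (G n)\<close> against \<open>m\<close> is testing \<open>G n\<close>
  against \<open>\<Phi> m\<close>, so weak continuity is automatic for an operator with a Radon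
  adjoint; the same holds for the transfunction.\<close>

lemma radon_adjoint_weakly_continuous_operator:
  "radon_adjoint \<Phi> S \<Longrightarrow> weakly_continuous_operator S"
  unfolding weakly_continuous_operator_def weakly_tendsto_fun_def
  by (simp add: radon_adjoint_pairing[symmetric])

lemma radon_adjoint_weakly_continuous_transfunction:
  "radon_adjoint \<Phi> S \<Longrightarrow> weakly_continuous_transfunction \<Phi>"
  unfolding weakly_continuous_transfunction_def weakly_tendsto_measure_def
  by (simp add: radon_adjoint_pairing)

lemma norm_dirac_image_le:
  fixes \<Phi> :: "'a::polish_space signed_measure \<Rightarrow> 'b::polish_space signed_measure"
  assumes \<Phi>: "bounded_linear \<Phi>"
  shows "norm (\<Phi> (dirac_sm x)) \<le> onorm \<Phi>"
proof -
  have "norm (\<Phi> (dirac_sm x)) \<le> onorm \<Phi> * norm (dirac_sm x)" by (rule onorm[OF \<Phi>])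
  also have "\<dots> \<le> onorm \<Phi> * 1" by (intro mult_left_mono norm_dirac_sm_le onorm_pos_le \<Phi>)
  finally show ?thesis by simp
qed

text \<open>The value of \<open>S g\<close> at a point is the pairing of \<open>g\<close> with the
  image of a Dirac measure, whose norm is at most \<open>onorm \<Phi>\<close>.\<close>

lemma norm_operator_le:
  fixes S :: "('b::polish_space \<Rightarrow>\<^sub>C real) \<Rightarrow> ('a::polish_space \<Rightarrow>\<^sub>C real)"
  assumes "radon_adjoint \<Phi> S" "bounded_linear \<Phi>"
  shows "norm (S g) \<le> onorm \<Phi> * norm g"
proof (rule norm_bound)
  fix x
  have "\<bar>S g x\<bar> = \<bar>pairing g (\<Phi> (dirac_sm x))\<bar>"
    by (simp add: radon_adjoint_pairing[OF assms(1)] pairing_dirac_sm)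
  also have "\<dots> \<le> norm g * norm (\<Phi> (dirac_sm x))" by (rule abs_pairing_le)
  also have "\<dots> \<le> norm g * onorm \<Phi>"
    by (rule mult_left_mono[OF norm_dirac_image_le[OF assms(2)] norm_ge_zero])
  finally show "norm (S g x) \<le> onorm \<Phi> * norm g" by (simp add: mult.commute)
qed

lemma norm_transfunction_le:
  fixes \<Phi> :: "'a::polish_space signed_measure \<Rightarrow> 'b::polish_space signed_measure"
  assumes "radon_adjoint \<Phi> S" "bounded_linear S"
  shows "norm (\<Phi> m) \<le> onorm S * norm m"
proof (rule norm_signed_measure_le)
  fix g
  have "pairing g (\<Phi> m) \<le> norm (S g) * norm m"
    using abs_pairing_le[of "S g" m] by (simp add: radon_adjoint_pairing[OF assms(1)])
  also have "\<dots> \<le> (onorm S * norm g) * norm m"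
    by (intro mult_right_mono onorm assms(2)) simp
  finally show "pairing g (\<Phi> m) \<le> onorm S * norm m * norm g" by (simp add: ac_simps)
qed

lemma onorm_radon_adjoint:
  fixes \<Phi> :: "'a::polish_space signed_measure \<Rightarrow> 'b::polish_space signed_measure"
  assumes "radon_adjoint \<Phi> S" "bounded_linear \<Phi>" "bounded_linear S"
  shows "onorm \<Phi> = onorm S"
  by (intro antisym onorm_bound norm_operator_le norm_transfunction_le onorm_pos_le assms)

lemma radon_adjoint_operator_exists:
  fixes \<Phi> :: "'a::polish_space signed_measure \<Rightarrow> 'b::polish_space signed_measure"
  assumes \<Phi>: "bounded_linear \<Phi>" and weak: "weakly_continuous_transfunction \<Phi>"
  shows "\<exists>S. bounded_linear S \<and> radon_adjoint \<Phi> S"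
proof -
  interpret \<Phi>: bounded_linear \<Phi> by fact
  have weak_lim: "(\<lambda>n. pairing g (\<Phi> (M n))) \<longlonglongrightarrow> pairing g (\<Phi> m)"
    if "weakly_tendsto_measure M m" for M m g
    using weak that unfolding weakly_continuous_transfunction_def
    unfolding weakly_tendsto_measure_def[of "\<lambda>n. \<Phi> (M n)" for M] by blast
  define s where "s g x = pairing g (\<Phi> (dirac_sm x))" for g x
  have "s g \<in> bcontfun" for g
  proof (rule bcontfun_normI)
    \<comment> \<open>Convergence of points makes their Dirac measures converge weakly, and
      \<open>\<Phi>\<close> preserves this. Sequences are enough because the space is
      metric.\<close>
    show "continuous_on UNIV (s g)"
      unfolding continuous_on_sequentially
    proof (intro ballI allI impI)
      fix X :: "nat \<Rightarrow> 'a" and x assume "(\<forall>n. X n \<in> UNIV) \<and> X \<longlonglongrightarrow> x"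
      then have X: "X \<longlonglongrightarrow> x" by simp
      have "(\<lambda>n. apply_bcontfun f (X n)) \<longlonglongrightarrow> f x" for f :: "'a \<Rightarrow>\<^sub>C real"
        by (rule continuous_on_tendsto_compose[OF continuous_on_apply_bcontfun[of UNIV] X]) auto
      then have "weakly_tendsto_measure (\<lambda>n. dirac_sm (X n)) (dirac_sm x)"
        by (simp add: weakly_tendsto_measure_def pairing_dirac_sm)
      then show "(s g \<circ> X) \<longlonglongrightarrow> s g x"
        unfolding o_def s_def by (rule weak_lim)
    qed
    show "norm (s g x) \<le> norm g * onorm \<Phi>" for x
      using abs_pairing_le[of g "\<Phi> (dirac_sm x)"]
        mult_left_mono[OF norm_dirac_image_le[OF \<Phi>, of x] norm_ge_zero, of g]
      by (simp add: s_def)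
  qed
  define S where "S g = Bcontfun (s g)" for g
  have S_apply: "S g x = pairing g (\<Phi> (dirac_sm x))" for g x
    using \<open>s g \<in> bcontfun\<close> by (simp add: S_def Bcontfun_inverse s_def)
  have adj: "radon_adjoint \<Phi> S"
    unfolding radon_adjoint_def
  proof (intro allI)
    fix g m
    show "pairing g (\<Phi> m) = pairing (S g) m"
    \<comment> \<open>Both sides are linear in \<open>m\<close> and agree on Dirac measures by the
      choice of \<open>S\<close>. Along weak limits the left side converges by weak continuity of
      \<open>\<Phi>\<close>, the right side by definition since \<open>S g\<close> is a fixed test
      function.\<close>
    proof (induction m rule: weak_sequential_induct)
      case (lim M m)
      from weak_lim[OF lim(2), of g]
      have "(\<lambda>n. pairing (S g) (M n)) \<longlonglongrightarrow> pairing g (\<Phi> m)" unfolding lim(1) .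
      moreover have "(\<lambda>n. pairing (S g) (M n)) \<longlonglongrightarrow> pairing (S g) m"
        using lim(2) by (simp add: weakly_tendsto_measure_def)
      ultimately show ?case by (rule LIMSEQ_unique)
    qed (simp_all add: pairing_dirac_sm S_apply \<Phi>.add \<Phi>.scaleR pairing_add_right pairing_scaleR_right)
  qed
  have "bounded_linear S"
  proof (rule bounded_linear_intro[where K = "onorm \<Phi>"])
    show "S (f + g) = S f + S g" "S (c *\<^sub>R g) = c *\<^sub>R S g" for f g c
      by (rule bcontfun_eqI, simp add: S_apply linear_add[OF linear_pairing_left]
          linear_scale[OF linear_pairing_left])+
    show "norm (S g) \<le> norm g * onorm \<Phi>" for g
      using norm_operator_le[OF adj \<Phi>, of g] by (simp add: mult.commute)
  qed
  with adj show ?thesis by blast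
qed

lemma radon_adjoint_transfunction_exists:
  fixes S :: "('b::polish_space \<Rightarrow>\<^sub>C real) \<Rightarrow> ('a::polish_space \<Rightarrow>\<^sub>C real)"
  assumes S: "bounded_linear S" and weak: "weakly_continuous_operator S"
  shows "\<exists>\<Phi>. bounded_linear \<Phi> \<and> radon_adjoint \<Phi> S"
proof -
  interpret S: bounded_linear S by fact
  have "sequential_functional (\<lambda>g. pairing (S g) m)" for m
  proof (intro sequential_functional.intro sequential_functional_axioms.intro)
    show "bounded_linear (\<lambda>g. pairing (S g) m)"
      by (rule bounded_linear_compose[OF pairing_bounded_linear_left S])
    fix G :: "nat \<Rightarrow> 'b \<Rightarrow>\<^sub>C real" and K
    assume "\<And>x. (\<lambda>n. G n x) \<longlonglongrightarrow> 0" "\<And>n. norm (G n) \<le> K"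
    then have "weakly_tendsto_fun G 0" by (intro weakly_tendsto_funI[where K = K]) auto
    then have "weakly_tendsto_fun (\<lambda>n. S (G n)) (S 0)"
      using weak unfolding weakly_continuous_operator_def by blast
    then show "(\<lambda>n. pairing (S (G n)) m) \<longlonglongrightarrow> 0"
      by (simp add: weakly_tendsto_fun_def S.zero linear_0[OF linear_pairing_left])
  qed
  then have "\<exists>n. \<forall>g. pairing g n = pairing (S g) m" for m
    by (rule sequential_functional.representation)
  then obtain \<Phi> where \<Phi>: "\<And>m g. pairing g (\<Phi> m) = pairing (S g) m" by metis
  then have adj: "radon_adjoint \<Phi> S" by (simp add: radon_adjoint_def)
  have "bounded_linear \<Phi>"
  proof (rule bounded_linear_intro[where K = "onorm S"])
    \<comment> \<open>The values of \<open>\<Phi>\<close> were chosen separately for each measure;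
      linearity follows because a signed measure is determined by its pairings.\<close>
    show "\<Phi> (m + n) = \<Phi> m + \<Phi> n" "\<Phi> (c *\<^sub>R m) = c *\<^sub>R \<Phi> m" for m n c
      by (rule signed_measure_eqI_pairing, simp add: \<Phi> pairing_add_right pairing_scaleR_right)+
    show "norm (\<Phi> m) \<le> norm m * onorm S" for m
      using norm_transfunction_le[OF adj S, of m] by (simp add: mult.commute)
  qed
  with adj show ?thesis by blast
qed

theorem theorem5p1:
  assumes "locally_compact_space (euclidean :: 'a::polish_space topology)"
    and "locally_compact_space (euclidean :: 'b::polish_space topology)"
  shows "(\<forall>\<Phi> :: 'a signed_measure \<Rightarrow> 'b signed_measure.
            strongly_sigma_additive \<Phi> \<and> weakly_continuous_transfunction \<Phi> \<longrightarrow>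
            (\<exists>S :: ('b \<Rightarrow>\<^sub>C real) \<Rightarrow> ('a \<Rightarrow>\<^sub>C real).
               strongly_sigma_additive S \<and> weakly_continuous_operator S \<and> radon_adjoint \<Phi> S))
       \<and> (\<forall>S :: ('b \<Rightarrow>\<^sub>C real) \<Rightarrow> ('a \<Rightarrow>\<^sub>C real).
            strongly_sigma_additive S \<and> weakly_continuous_operator S \<longrightarrow>
            (\<exists>\<Phi> :: 'a signed_measure \<Rightarrow> 'b signed_measure.
               strongly_sigma_additive \<Phi> \<and> weakly_continuous_transfunction \<Phi> \<and> radon_adjoint \<Phi> S))
       \<and> (\<forall>(\<Phi> :: 'a signed_measure \<Rightarrow> 'b signed_measure) (S :: ('b \<Rightarrow>\<^sub>C real) \<Rightarrow> ('a \<Rightarrow>\<^sub>C real)).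
            strongly_sigma_additive \<Phi> \<and> weakly_continuous_transfunction \<Phi> \<and>
            strongly_sigma_additive S \<and> weakly_continuous_operator S \<and> radon_adjoint \<Phi> S \<longrightarrow>
            onorm \<Phi> = onorm S)"
  unfolding strongly_sigma_additive_iff
  using radon_adjoint_operator_exists[where 'a = 'a and 'b = 'b]
    radon_adjoint_transfunction_exists[where 'a = 'a and 'b = 'b]
    radon_adjoint_weakly_continuous_operator radon_adjoint_weakly_continuous_transfunction
    onorm_radon_adjoint[where 'a = 'a and 'b = 'b]
  by metis

end
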